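(* Let $(M,P,N)$ be a Poisson-Nijenhuis manifold with a volume form $\mu$, and for $k\ge 1$ let $X^{(k)}=X^k_\mu-N X^{k-1}_\mu$ be its $k$-th modular vector field. Then, for all $k\ge1$, $$X^{(k)}=-\tfrac12\,H^P_{I_k},$$ where $I_k=\mathrm{Tr}\,\frac{N^k}{k}$ and $H^P_{I_k}=P\,dI_k$ is the hamiltonian vector field of $I_k$ with respect to $P$.
   Context: Conventions. A bivector $P$ also denotes the map from $1$-forms to vector fields $P\alpha=i_\alpha P$, so that $\langle P\alpha,\beta\rangle=P(\alpha,\beta)$. ${}^tN$ is the transpose of the $(1,1)$-tensor $N$, acting on $1$-forms. The hamiltonian vector field of $f$ with respect to a Poisson bivector $Q$ is $H^Q_f=Q\,df$. For a bivector $Q$, the bracket of $1$-forms is $[\alpha,\beta]_Q=L_{Q\alpha}\beta-L_{Q\beta}\alpha-d(Q(\alpha,\beta))$. A Poisson-Nijenhuis manifold is a smooth manifold $M$ with a pair $(P,N)$ where $P$ is a Poisson bivector and $N$ is a Nijenhuis tensor (a $(1,1)$-tensor with vanishing Nijenhuis torsion) that are compatible, i.e. $N\circ P=P\circ{}^tN$ and, for all $1$-forms $\alpha,\beta$, $$[\alpha,\beta]_{NP}=[{}^tN\alpha,\beta]_P+[\alpha,{}^tN\beta]_P-{}^tN[\alpha,\beta]_P ,$$ where $NP$ is the bivector corresponding to the map $N\circ P$. It is known that then $P_0=P$, $P_1=NP$, ..., $P_k=N^kP$, ... are pairwise-compatible Poisson bivectors, and that each $(P_k,N)$ is again a compatible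 pair. For each $k\ge0$, the modular vector field $X^k_\mu$ of the Poisson structure $P_k$ associated with the volume form $\mu$ is defined by $\langle X^k_\mu,df\rangle\,\mu=L_{H^{P_k}_f}\mu$ for all $f\in C^\infty(M)$. The vector field $X^{(k)}=X^k_\mu-NX^{k-1}_\mu$, $k\ge1$, is independent of the choice of $\mu$ and is called the $k$-th modular vector field of $(M,P,N)$. *)

theory Defs
  imports "HOL-Analysis.Analysis"
begin

(* Ck_on k f S: f is of class C^k on the open set S, by iterated directional derivatives. *)
primrec Ck_on :: "nat \<Rightarrow> ('a::real_normed_vector \<Rightarrow> 'b::real_normed_vector) \<Rightarrow> 'a set \<Rightarrow> bool" where
  "Ck_on 0 f S \<longleftrightarrow> continuous_on S f"
| "Ck_on (Suc k) f S \<longleftrightarrow>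
     (\<forall>x\<in>S. f differentiable (at x)) \<and>
     (\<forall>v. Ck_on k (\<lambda>x. frechet_derivative f (at x) v) S)"

definition smooth_on :: "('a::real_normed_vector \<Rightarrow> 'b::real_normed_vector) \<Rightarrow> 'a set \<Rightarrow> bool" where
  "smooth_on f S \<longleftrightarrow> (\<forall>k. Ck_on k f S)"


(* The underlying set of the manifold is the type 'm, which is required to be Hausdorff and
   second countable; the dimension is CARD('n). A chart is a pair (domain, coordinate map);
   the coordinate map is only relevant on the domain. *)
type_synonym ('m, 'n) chart = "'m set \<times> ('m \<Rightarrow> real ^ 'n)"

definition chart_image :: "('m, 'n) chart \<Rightarrow> (real ^ 'n) set" where
  "chart_image c = snd c ` fst c"

definition chart_inv :: "('m, 'n) chart \<Rightarrow> real ^ 'n \<Rightarrow> 'm" where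
  "chart_inv c = inv_into (fst c) (snd c)"

definition is_chart :: "('m::topological_space, 'n::finite) chart \<Rightarrow> bool" where
  "is_chart c \<longleftrightarrow> open (fst c) \<and> open (chart_image c) \<and>
     homeomorphism (fst c) (chart_image c) (snd c) (chart_inv c)"

definition overlap :: "('m, 'n) chart \<Rightarrow> ('m, 'n) chart \<Rightarrow> (real ^ 'n) set" where
  "overlap c d = snd c ` (fst c \<inter> fst d)"

definition transition :: "('m, 'n) chart \<Rightarrow> ('m, 'n) chart \<Rightarrow> real ^ 'n \<Rightarrow> real ^ 'n" where
  "transition c d = snd d \<circ> chart_inv c"

definition smooth_atlas :: "('m::{t2_space, second_countable_topology}, 'n::finite) chart set \<Rightarrow> bool" where
  "smooth_atlas A \<longleftrightarrow>
     (\<forall>c\<in>A. is_chart c) \<and> (\<Union>c\<in>A. fst c) = UNIV \<and>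
     (\<forall>c\<in>A. \<forall>d\<in>A. smooth_on (transition c d) (overlap c d))"

definition local_rep :: "('m \<Rightarrow> real) \<Rightarrow> ('m, 'n) chart \<Rightarrow> real ^ 'n \<Rightarrow> real" where
  "local_rep f c = f \<circ> chart_inv c"

definition smooth_function :: "('m, 'n::finite) chart set \<Rightarrow> ('m \<Rightarrow> real) \<Rightarrow> bool" where
  "smooth_function A f \<longleftrightarrow> (\<forall>c\<in>A. smooth_on (local_rep f c) (chart_image c))"


(* A tensor field T is the family of its coordinate expressions: T c x is its value at the point
   with coordinates x in the chart c, relevant only for c in the atlas and x in chart_image c.
   Expressions in different charts are related by the transformation law of the tensor type.
   Tangent vectors, covectors, endomorphisms and bivectors are given by components: the covector
   a maps the vector v to a \<bullet> v, N acts by N *v v, its transpose acts on covectors, and a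
   bivector is the matrix of the map P from covectors to vectors with
   P(a,b) = (P *v a) \<bullet> b. *)
type_synonym ('m, 'n, 't) field = "('m, 'n) chart \<Rightarrow> real ^ 'n \<Rightarrow> 't"

definition vector_field ::
  "('m, 'n::finite) chart set \<Rightarrow> ('m, 'n, real ^ 'n) field \<Rightarrow> bool" where
  "vector_field A X \<longleftrightarrow>
     (\<forall>c\<in>A. smooth_on (X c) (chart_image c)) \<and>
     (\<forall>c\<in>A. \<forall>d\<in>A. \<forall>x\<in>overlap c d.
        X d (transition c d x) = jacobian (transition c d) (at x) *v X c x)"

definition one_form ::
  "('m, 'n::finite) chart set \<Rightarrow> ('m, 'n, real ^ 'n) field \<Rightarrow> bool" where
  "one_form A \<alpha> \<longleftrightarrow>
     (\<forall>c\<in>A. smooth_on (\<alpha> c) (chart_image c)) \<and>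
     (\<forall>c\<in>A. \<forall>d\<in>A. \<forall>x\<in>overlap c d.
        \<alpha> c x = transpose (jacobian (transition c d) (at x)) *v \<alpha> d (transition c d x))"

definition endo_field ::
  "('m, 'n::finite) chart set \<Rightarrow> ('m, 'n, real ^ 'n ^ 'n) field \<Rightarrow> bool" where
  "endo_field A N \<longleftrightarrow>
     (\<forall>c\<in>A. smooth_on (N c) (chart_image c)) \<and>
     (\<forall>c\<in>A. \<forall>d\<in>A. \<forall>x\<in>overlap c d.
        N d (transition c d x) ** jacobian (transition c d) (at x) = jacobian (transition c d) (at x) ** N c x)"

definition bivector_field ::
  "('m, 'n::finite) chart set \<Rightarrow> ('m, 'n, real ^ 'n ^ 'n) field \<Rightarrow> bool" where
  "bivector_field A P \<longleftrightarrow>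
     (\<forall>c\<in>A. smooth_on (P c) (chart_image c)) \<and>
     (\<forall>c\<in>A. \<forall>x\<in>chart_image c. transpose (P c x) = - P c x) \<and>
     (\<forall>c\<in>A. \<forall>d\<in>A. \<forall>x\<in>overlap c d.
        P d (transition c d x) =
          jacobian (transition c d) (at x) ** P c x ** transpose (jacobian (transition c d) (at x)))"

(* An alternating form of top degree on R^n: the i-th argument is the i-th row v $ i of v. *)
definition alternating_form :: "(real ^ 'n ^ 'n \<Rightarrow> real) \<Rightarrow> bool" where
  "alternating_form \<omega> \<longleftrightarrow>
     (\<forall>i v. linear (\<lambda>u. \<omega> (\<chi> j. if j = i then u else v $ j))) \<and>
     (\<forall>v i j. i \<noteq> j \<longrightarrow> v $ i = v $ j \<longrightarrow> \<omega> v = 0)"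

definition volume_form ::
  "('m, 'n::finite) chart set \<Rightarrow> ('m, 'n, real ^ 'n ^ 'n \<Rightarrow> real) field \<Rightarrow> bool" where
  "volume_form A \<mu> \<longleftrightarrow>
     (\<forall>c\<in>A. \<forall>v. smooth_on (\<lambda>x. \<mu> c x v) (chart_image c)) \<and>
     (\<forall>c\<in>A. \<forall>x\<in>chart_image c. alternating_form (\<mu> c x) \<and> (\<exists>v. \<mu> c x v \<noteq> 0)) \<and>
     (\<forall>c\<in>A. \<forall>d\<in>A. \<forall>x\<in>overlap c d. \<forall>v.
        \<mu> c x v = \<mu> d (transition c d x) (\<chi> i. jacobian (transition c d) (at x) *v (v $ i)))"


(* The operators below act on coordinate expressions in a single chart. They are natural, so the
   equations between tensor fields stated with them do not depend on the chart. *)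

definition d_fun :: "(real ^ 'n \<Rightarrow> real) \<Rightarrow> real ^ 'n \<Rightarrow> real ^ 'n" where
  "d_fun f x = (\<chi> i. frechet_derivative f (at x) (axis i 1))"

definition lie_bracket ::
  "(real ^ 'n \<Rightarrow> real ^ 'n) \<Rightarrow> (real ^ 'n \<Rightarrow> real ^ 'n) \<Rightarrow> real ^ 'n \<Rightarrow> real ^ 'n" where
  "lie_bracket X Y x =
     frechet_derivative Y (at x) (X x) - frechet_derivative X (at x) (Y x)"

(* (L_X a)_i = X^j d_j a_i + a_j d_i X^j *)
definition lie_one_form ::
  "(real ^ 'n \<Rightarrow> real ^ 'n) \<Rightarrow> (real ^ 'n \<Rightarrow> real ^ 'n) \<Rightarrow> real ^ 'n \<Rightarrow> real ^ 'n" where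
  "lie_one_form X \<alpha> x =
     frechet_derivative \<alpha> (at x) (X x) +
     (\<chi> i. \<alpha> x \<bullet> frechet_derivative X (at x) (axis i 1))"

(* (L_X m)(v_1,...,v_n) = X(m(v_1,...,v_n)) - (sum over i of m(v_1,...,[X,v_i],...,v_n))
   for constant vector fields v_i, for which [X,v_i] = - DX(v_i). *)
definition lie_top_form ::
  "(real ^ 'n \<Rightarrow> real ^ 'n) \<Rightarrow> (real ^ 'n \<Rightarrow> real ^ 'n ^ 'n \<Rightarrow> real) \<Rightarrow>
   real ^ 'n \<Rightarrow> real ^ 'n ^ 'n \<Rightarrow> real" where
  "lie_top_form X \<mu> x v =
     frechet_derivative (\<lambda>y. \<mu> y v) (at x) (X x) +
     (\<Sum>i\<in>UNIV. \<mu> x (\<chi> j. if j = i then frechet_derivative X (at x) (v $ j) else v $ j))"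

definition ham :: "(real ^ 'n \<Rightarrow> real ^ 'n ^ 'n) \<Rightarrow> (real ^ 'n \<Rightarrow> real) \<Rightarrow> real ^ 'n \<Rightarrow> real ^ 'n" where
  "ham Q f x = Q x *v d_fun f x"

definition poisson_bracket ::
  "(real ^ 'n \<Rightarrow> real ^ 'n ^ 'n) \<Rightarrow> (real ^ 'n \<Rightarrow> real) \<Rightarrow> (real ^ 'n \<Rightarrow> real) \<Rightarrow> real ^ 'n \<Rightarrow> real" where
  "poisson_bracket Q f g x = (Q x *v d_fun f x) \<bullet> d_fun g x"

(* [a,b]_Q = L_{Qa} b - L_{Qb} a - d(Q(a,b)) *)
definition form_bracket ::
  "(real ^ 'n \<Rightarrow> real ^ 'n ^ 'n) \<Rightarrow> (real ^ 'n \<Rightarrow> real ^ 'n) \<Rightarrow> (real ^ 'n \<Rightarrow> real ^ 'n) \<Rightarrow>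
   real ^ 'n \<Rightarrow> real ^ 'n" where
  "form_bracket Q \<alpha> \<beta> x =
     lie_one_form (\<lambda>y. Q y *v \<alpha> y) \<beta> x - lie_one_form (\<lambda>y. Q y *v \<beta> y) \<alpha> x -
     d_fun (\<lambda>y. (Q y *v \<alpha> y) \<bullet> \<beta> y) x"

definition torsion ::
  "(real ^ 'n \<Rightarrow> real ^ 'n ^ 'n) \<Rightarrow> (real ^ 'n \<Rightarrow> real ^ 'n) \<Rightarrow> (real ^ 'n \<Rightarrow> real ^ 'n) \<Rightarrow>
   real ^ 'n \<Rightarrow> real ^ 'n" where
  "torsion N X Y x =
     lie_bracket (\<lambda>y. N y *v X y) (\<lambda>y. N y *v Y y) x -
     N x *v (lie_bracket (\<lambda>y. N y *v X y) Y x + lie_bracket X (\<lambda>y. N y *v Y y) x -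
             N x *v lie_bracket X Y x)"


definition poisson_bivector ::
  "('m, 'n::finite) chart set \<Rightarrow> ('m, 'n, real ^ 'n ^ 'n) field \<Rightarrow> bool" where
  "poisson_bivector A P \<longleftrightarrow> bivector_field A P \<and>
     (\<forall>f g h. smooth_function A f \<longrightarrow> smooth_function A g \<longrightarrow> smooth_function A h \<longrightarrow>
       (\<forall>c\<in>A. \<forall>x\<in>chart_image c.
          (let f' = local_rep f c; g' = local_rep g c; h' = local_rep h c in
             poisson_bracket (P c) f' (poisson_bracket (P c) g' h') x +
             poisson_bracket (P c) g' (poisson_bracket (P c) h' f') x +
             poisson_bracket (P c) h' (poisson_bracket (P c) f' g') x = 0)))"

definition nijenhuis_tensor ::
  "('m, 'n::finite) chart set \<Rightarrow> ('m, 'n, real ^ 'n ^ 'n) field \<Rightarrow> bool" where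
  "nijenhuis_tensor A N \<longleftrightarrow> endo_field A N \<and>
     (\<forall>X Y. vector_field A X \<longrightarrow> vector_field A Y \<longrightarrow>
       (\<forall>c\<in>A. \<forall>x\<in>chart_image c. torsion (N c) (X c) (Y c) x = 0))"

definition mpow :: "real ^ 'n ^ 'n \<Rightarrow> nat \<Rightarrow> real ^ 'n ^ 'n" where
  "mpow B k = (((**) B) ^^ k) (mat 1)"

definition hierarchy ::
  "('m, 'n::finite, real ^ 'n ^ 'n) field \<Rightarrow> ('m, 'n, real ^ 'n ^ 'n) field \<Rightarrow> nat \<Rightarrow>
   ('m, 'n, real ^ 'n ^ 'n) field" where
  "hierarchy P N k c x = mpow (N c x) k ** P c x"

definition compatible_pair ::
  "('m, 'n::finite) chart set \<Rightarrow> ('m, 'n, real ^ 'n ^ 'n) field \<Rightarrow>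
   ('m, 'n, real ^ 'n ^ 'n) field \<Rightarrow> bool" where
  "compatible_pair A P N \<longleftrightarrow>
     (\<forall>c\<in>A. \<forall>x\<in>chart_image c. N c x ** P c x = P c x ** transpose (N c x)) \<and>
     (\<forall>\<alpha> \<beta>. one_form A \<alpha> \<longrightarrow> one_form A \<beta> \<longrightarrow>
       (\<forall>c\<in>A. \<forall>x\<in>chart_image c.
          form_bracket (\<lambda>y. N c y ** P c y) (\<alpha> c) (\<beta> c) x =
            form_bracket (P c) (\<lambda>y. transpose (N c y) *v \<alpha> c y) (\<beta> c) x +
            form_bracket (P c) (\<alpha> c) (\<lambda>y. transpose (N c y) *v \<beta> c y) x -
            transpose (N c x) *v form_bracket (P c) (\<alpha> c) (\<beta> c) x))"

definition poisson_nijenhuis_manifold ::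
  "('m::{t2_space, second_countable_topology}, 'n::finite) chart set \<Rightarrow>
   ('m, 'n, real ^ 'n ^ 'n) field \<Rightarrow> ('m, 'n, real ^ 'n ^ 'n) field \<Rightarrow> bool" where
  "poisson_nijenhuis_manifold A P N \<longleftrightarrow>
     smooth_atlas A \<and> poisson_bivector A P \<and> nijenhuis_tensor A N \<and> compatible_pair A P N"

(* X is the modular vector field of Q with respect to the volume form \<mu>:
   \<langle>X, df\<rangle> \<mu> = L_{H_f} \<mu> for every smooth function f on the whole manifold. This determines X c x
   for c in the atlas and x in chart_image c. *)
definition is_modular_vector_field ::
  "('m, 'n::finite) chart set \<Rightarrow> ('m, 'n, real ^ 'n ^ 'n) field \<Rightarrow>
   ('m, 'n, real ^ 'n ^ 'n \<Rightarrow> real) field \<Rightarrow> ('m, 'n, real ^ 'n) field \<Rightarrow> bool" where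
  "is_modular_vector_field A Q \<mu> X \<longleftrightarrow> vector_field A X \<and>
     (\<forall>f. smooth_function A f \<longrightarrow>
       (\<forall>c\<in>A. \<forall>x\<in>chart_image c. \<forall>v.
          (X c x \<bullet> d_fun (local_rep f c) x) * \<mu> c x v =
            lie_top_form (ham (Q c) (local_rep f c)) (\<mu> c) x v))"

definition kth_modular_field ::
  "('m, 'n::finite, real ^ 'n ^ 'n) field \<Rightarrow> (nat \<Rightarrow> ('m, 'n, real ^ 'n) field) \<Rightarrow> nat \<Rightarrow>
   ('m, 'n, real ^ 'n) field" where
  "kth_modular_field N X k c x = X k c x - N c x *v X (k - 1) c x"

definition trace_function ::
  "('m, 'n::finite, real ^ 'n ^ 'n) field \<Rightarrow> nat \<Rightarrow> ('m, 'n, real) field" where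
  "trace_function N k c x = trace (mpow (N c x) k) / real k"

end

theory Submission
  imports Defs
begin

text \<open>
  The proof is a computation in one chart. Write \<open>Q = N\<^sup>k\<^sup>-\<^sup>1 P\<close> and let \<open>m\<close> be the density of the volume
  form. The modular field of a bivector \<open>R\<close> has the components \<open>\<partial>\<^sub>i R\<^sub>i\<^sub>j - R\<^sub>j\<^sub>i \<partial>\<^sub>i log m\<close>. Since
  \<open>N Q = Q N\<^sup>t\<close>, everything cancels in the difference of the modular field of \<open>N Q\<close> and the image under
  \<open>N\<close> of the modular field of \<open>Q\<close>, except for the terms in which \<open>N\<close> is differentiated: the
  \<open>k\<close>-th modular field is \<open>Y\<^sub>b = Q\<^sub>m\<^sub>l \<partial>\<^sub>m N\<^sub>b\<^sub>l\<close> (lemma \<open>modular_difference\<close>).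

  The compatibility condition, evaluated on the differentials of two coordinates, says that
  \<open>P\<^sub>l\<^sub>b \<partial>\<^sub>j N\<^sub>a\<^sub>l = P\<^sub>m\<^sub>b \<partial>\<^sub>m N\<^sub>a\<^sub>j - P\<^sub>m\<^sub>a \<partial>\<^sub>m N\<^sub>b\<^sub>j + N\<^sub>b\<^sub>l \<partial>\<^sub>j P\<^sub>a\<^sub>l - N\<^sub>l\<^sub>j \<partial>\<^sub>l P\<^sub>a\<^sub>b\<close>
  (lemma \<open>concomitant_in_coordinates\<close>). Contract this with the matrix \<open>N\<^sup>k\<^sup>-\<^sup>1\<close> over \<open>j\<close> and \<open>a\<close>. The first
  term on the right becomes \<open>P\<^sub>m\<^sub>b Tr (N\<^sup>k\<^sup>-\<^sup>1 \<partial>\<^sub>m N)\<close> and the second one \<open>-Y\<^sub>b\<close>. By the derivative of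
  \<open>N P = P N\<^sup>t\<close> the remaining terms, moved to the left, add up to another \<open>Y\<^sub>b\<close>. Hence
  \<open>2 Y\<^sub>b = P\<^sub>m\<^sub>b Tr (N\<^sup>k\<^sup>-\<^sup>1 \<partial>\<^sub>m N)\<close> (lemma \<open>contracted_concomitant\<close>). As \<open>P\<close> is skew and
  \<open>\<partial>\<^sub>m Tr (N\<^sup>k / k) = Tr (N\<^sup>k\<^sup>-\<^sup>1 \<partial>\<^sub>m N)\<close>, this is the claim.

  What remains is the passage from global to local. The hypotheses speak about functions and forms
  on the whole manifold, while the computation needs coordinates. Smooth bump functions supply global
  functions that coincide with a coordinate near a given point (lemma \<open>coordinate_function_exists\<close>).
\<close>

section \<open>Calculus of maps of class C-k\<close>

lemma Ck_on_Suc_imp: "Ck_on (Suc k) f S \<Longrightarrow> Ck_on k f S"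
proof (induction k arbitrary: f)
  case 0
  then show ?case
    by (auto intro!: continuous_at_imp_continuous_on differentiable_imp_continuous_within)
next
  case (Suc k)
  then show ?case by (metis Ck_on.simps(2))
qed

lemma Ck_on_cong:
  assumes "open S" "\<And>x. x \<in> S \<Longrightarrow> f x = g x"
  shows "Ck_on k f S \<longleftrightarrow> Ck_on k g S"
  using assms(2)
proof (induction k arbitrary: f g)
  case 0
  then show ?case by (auto cong: continuous_on_cong)
next
  case (Suc k)
  have *: "f differentiable at x \<longleftrightarrow> g differentiable at x" if "x \<in> S" for x
    using has_derivative_transform_within_open[OF _ assms(1) that, of f _ UNIV g]
      has_derivative_transform_within_open[OF _ assms(1) that, of g _ UNIV f] Suc.prems
    unfolding differentiable_def by metis
  show ?case
  proof (cases "\<forall>x\<in>S. f differentiable at x")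
    case True
    have "frechet_derivative f (at x) = frechet_derivative g (at x)" if "x \<in> S" for x
      using frechet_derivative_transform_within_open[OF _ assms(1) that] True that Suc.prems by blast
    then have "Ck_on k (\<lambda>x. frechet_derivative f (at x) v) S
        \<longleftrightarrow> Ck_on k (\<lambda>x. frechet_derivative g (at x) v) S" for v
      by (intro Suc.IH) auto
    then show ?thesis using * by simp
  qed (use * in auto)
qed

text \<open>Membership in the class is a local property, which is what makes it possible to glue a
  function on the manifold from pieces that live in different charts.\<close>

lemma Ck_on_local:
  assumes "\<And>x. x \<in> S \<Longrightarrow> \<exists>U. open U \<and> x \<in> U \<and> Ck_on k f U"
  shows "Ck_on k f S"
  using assms
proof (induction k arbitrary: f)
  case 0
  have "continuous (at x) f" if "x \<in> S" for x
    using 0[OF that] by (auto simp: continuous_on_eq_continuous_at)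
  then show ?case by (auto intro: continuous_at_imp_continuous_on)
next
  case (Suc k)
  have "f differentiable at x" if "x \<in> S" for x
    using Suc.prems[OF that] by auto
  moreover have "Ck_on k (\<lambda>x. frechet_derivative f (at x) v) S" for v
    by (rule Suc.IH) (use Suc.prems in force)
  ultimately show ?case by simp
qed

lemma Ck_on_const: "Ck_on k (\<lambda>x. c) S"
  by (induction k arbitrary: c) auto

text \<open>To climb one step in the order of differentiability it suffices to know some derivative whose
  values in each fixed direction are of the lower class.\<close>

lemma Ck_on_SucI:
  assumes "open S" "\<And>x. x \<in> S \<Longrightarrow> (f has_derivative f' x) (at x)"
    and "\<And>v. Ck_on k (\<lambda>x. f' x v) S"
  shows "Ck_on (Suc k) f S"
proof -
  have "Ck_on k (\<lambda>x. frechet_derivative f (at x) v) S" for v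
    using Ck_on_cong[OF assms(1), of "\<lambda>x. frechet_derivative f (at x) v" "\<lambda>x. f' x v"] assms(3)
      frechet_derivative_at[OF assms(2)] by auto
  then show ?thesis using assms(2) by (auto simp: differentiable_def)
qed

lemma Ck_on_has_derivative:
  assumes "Ck_on (Suc k) f S" "x \<in> S"
  shows "(f has_derivative frechet_derivative f (at x)) (at x)"
  using assms by (auto simp: frechet_derivative_works)

lemma Ck_on_ident: "open S \<Longrightarrow> Ck_on k (\<lambda>x. x) S"
  by (cases k) (auto intro!: Ck_on_SucI Ck_on_const derivative_eq_intros)

lemma Ck_on_bounded_linear:
  assumes "bounded_linear L" "open S" "Ck_on k f S"
  shows "Ck_on k (\<lambda>x. L (f x)) S"
  using assms(3)
proof (induction k arbitrary: f)
  case 0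
  then show ?case using bounded_linear.continuous_on[OF assms(1)] by auto
next
  case (Suc k)
  show ?case
  proof (rule Ck_on_SucI[OF assms(2)])
    show "((\<lambda>x. L (f x)) has_derivative (\<lambda>v. L (frechet_derivative f (at x) v))) (at x)"
      if "x \<in> S" for x
      by (rule bounded_linear.has_derivative[OF assms(1) Ck_on_has_derivative[OF Suc.prems that]])
  qed (use Suc in auto)
qed

lemma Ck_on_add:
  assumes "open S" "Ck_on k f S" "Ck_on k g S"
  shows "Ck_on k (\<lambda>x. f x + g x) S"
  using assms(2,3)
proof (induction k arbitrary: f g)
  case 0
  then show ?case by (auto intro: continuous_on_add)
next
  case (Suc k)
  show ?case
  proof (rule Ck_on_SucI[OF assms(1)])
    show "((\<lambda>x. f x + g x) has_derivative
        (\<lambda>v. frechet_derivative f (at x) v + frechet_derivative g (at x) v)) (at x)"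
      if "x \<in> S" for x
      using Suc.prems that by (intro has_derivative_add Ck_on_has_derivative)
  qed (use Suc in auto)
qed

lemma Ck_on_sum:
  assumes "open S" "\<And>i. i \<in> I \<Longrightarrow> Ck_on k (f i) S"
  shows "Ck_on k (\<lambda>x. \<Sum>i\<in>I. f i x) S"
  using assms(2)
  by (induction I rule: infinite_finite_induct) (auto intro: Ck_on_add assms(1) Ck_on_const)

lemma Ck_on_bilinear:
  assumes "bounded_bilinear b" "open S" "Ck_on k f S" "Ck_on k g S"
  shows "Ck_on k (\<lambda>x. b (f x) (g x)) S"
  using assms(3,4)
proof (induction k arbitrary: f g)
  case 0
  then show ?case using bounded_bilinear.continuous_on[OF assms(1)] by auto
next
  case (Suc k)
  show ?case
  proof (rule Ck_on_SucI[OF assms(2)])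
    show "((\<lambda>x. b (f x) (g x)) has_derivative
        (\<lambda>v. b (f x) (frechet_derivative g (at x) v) + b (frechet_derivative f (at x) v) (g x))) (at x)"
      if "x \<in> S" for x
      using Suc.prems that by (intro bounded_bilinear.FDERIV[OF assms(1)] Ck_on_has_derivative)
    show "Ck_on k (\<lambda>x. b (f x) (frechet_derivative g (at x) v)
        + b (frechet_derivative f (at x) v) (g x)) S" for v
      using Suc.prems Ck_on_Suc_imp[of k f S] Ck_on_Suc_imp[of k g S]
      by (intro Ck_on_add assms(2) Suc.IH) auto
  qed
qed

text \<open>The chain rule expresses the directional derivatives of a composition through the coordinates
  of the inner derivative and the directional derivatives of the outer map along a fixed basis; both
  are again covered by the induction hypothesis.\<close>

lemma Ck_on_compose:
  fixes f :: "'a::real_normed_vector \<Rightarrow> 'b::euclidean_space"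
  assumes "open S" "open T" "f ` S \<subseteq> T" "Ck_on k f S" "Ck_on k g T"
  shows "Ck_on k (\<lambda>x. g (f x)) S"
  using assms(3-5)
proof (induction k arbitrary: f g)
  case 0
  then show ?case by (auto intro: continuous_on_compose2)
next
  case (Suc k)
  show ?case
  proof (rule Ck_on_SucI[OF assms(1)])
    fix x assume x: "x \<in> S"
    let ?f' = "frechet_derivative f (at x)" and ?g' = "frechet_derivative g (at (f x))"
    have f': "(f has_derivative ?f') (at x)" and g': "(g has_derivative ?g') (at (f x))"
      using Suc.prems x by (auto intro!: Ck_on_has_derivative)
    have "?g' (?f' v) = (\<Sum>i\<in>Basis. (?f' v \<bullet> i) *\<^sub>R ?g' i)" for v
    proof -
      have "?g' (?f' v) = ?g' (\<Sum>i\<in>Basis. (?f' v \<bullet> i) *\<^sub>R i)"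
        by (simp add: euclidean_representation)
      also have "\<dots> = (\<Sum>i\<in>Basis. (?f' v \<bullet> i) *\<^sub>R ?g' i)"
        using has_derivative_linear[OF g'] by (simp add: linear_sum linear_scale)
      finally show ?thesis .
    qed
    then show "((\<lambda>x. g (f x)) has_derivative
        (\<lambda>v. \<Sum>i\<in>Basis. (?f' v \<bullet> i) *\<^sub>R ?g' i)) (at x)"
      using diff_chain_at[OF f' g'] by (simp add: o_def)
  next
    fix v
    show "Ck_on k (\<lambda>x. \<Sum>i\<in>Basis. (frechet_derivative f (at x) v \<bullet> i) *\<^sub>R
        frechet_derivative g (at (f x)) i) S"
    proof (intro Ck_on_sum Ck_on_bilinear[OF bounded_bilinear_scaleR] assms(1))
      fix i :: 'b
      show "Ck_on k (\<lambda>x. frechet_derivative f (at x) v \<bullet> i) S"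
        using Suc.prems by (intro Ck_on_bounded_linear[OF bounded_linear_inner_left] assms(1)) auto
      show "Ck_on k (\<lambda>x. frechet_derivative g (at (f x)) i) S"
        using Suc.prems by (intro Suc.IH[of f "\<lambda>y. frechet_derivative g (at y) i"]) (auto intro: Ck_on_Suc_imp)
    qed
  qed
qed

lemma Ck_on_vec:
  fixes f :: "'a::real_normed_vector \<Rightarrow> real ^ 'n::finite"
  assumes "open S" "\<And>i. Ck_on k (\<lambda>x. f x $ i) S"
  shows "Ck_on k f S"
proof -
  have "f x = (\<Sum>i\<in>UNIV. f x $ i *\<^sub>R axis i 1)" for x
    by (simp add: vec_eq_iff sum_component axis_def if_distrib cong: if_cong)
  moreover have "Ck_on k (\<lambda>x. \<Sum>i\<in>UNIV. f x $ i *\<^sub>R (axis i 1 :: real ^ 'n)) S"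
    by (intro Ck_on_sum Ck_on_bounded_linear[OF bounded_linear_scaleR_left] assms)
  ultimately show ?thesis by simp
qed

lemma Ck_on_inverse: "Ck_on k (inverse :: real \<Rightarrow> real) {0<..}"
proof (induction k)
  case 0
  then show ?case by (auto intro!: continuous_intros)
next
  case (Suc k)
  show ?case
  proof (rule Ck_on_SucI)
    show "(inverse has_derivative (\<lambda>v. - (inverse x * v * inverse x))) (at x)"
      if "x \<in> {0<..}" for x :: real
      using that by (auto intro: has_derivative_inverse')
    show "Ck_on k (\<lambda>x. - (inverse x * v * inverse x)) {0<..}" for v :: real
      using Suc
      by (intro Ck_on_bounded_linear[OF bounded_linear_minus[OF bounded_linear_ident]]
        Ck_on_bilinear[OF bounded_bilinear_mult]) (auto simp: Ck_on_const)
  qed simp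
qed


section \<open>Smooth bump functions\<close>

text \<open>The functions \<open>t\<^sup>-\<^sup>n exp (-1/t)\<close>, extended by zero to \<open>t \<le> 0\<close>. The powers are included because
  the family is then closed under differentiation.\<close>

definition flat :: "nat \<Rightarrow> real \<Rightarrow> real" where
  "flat n t = (if t \<le> 0 then 0 else inverse t ^ n * exp (- inverse t))"

lemma flat_tendsto_0: "(flat n \<longlongrightarrow> 0) (at 0)"
proof -
  have "((\<lambda>t. inverse t ^ n / exp (inverse t)) \<longlongrightarrow> (0::real)) (at_right 0)"
    by (rule filterlim_compose[OF tendsto_power_div_exp_0 filterlim_inverse_at_top_right])
  then have "(flat n \<longlongrightarrow> 0) (at_right 0)"
    by (rule Lim_transform_eventually)
      (auto simp: eventually_at_right_field flat_def exp_minus field_simps intro!: exI[of _ 1])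
  moreover have "(flat n \<longlongrightarrow> 0) (at_left 0)"
    by (rule tendsto_eventually) (auto simp: eventually_at_left_field flat_def intro!: exI[of _ "-1"])
  ultimately show ?thesis by (intro filterlim_split_at)
qed

lemma flat_has_derivative:
  "(flat n has_field_derivative (flat (n + 2) t - real n * flat (n + 1) t)) (at t)"
proof -
  consider "t < 0" | "t = 0" | "t > 0" by linarith
  then show ?thesis
  proof cases
    case 1
    have "((\<lambda>x. 0) has_field_derivative (flat (n + 2) t - real n * flat (n + 1) t)) (at t)"
      using 1 by (auto simp: flat_def)
    then show ?thesis
      by (rule has_field_derivative_transform_within_open[of _ _ _ "{..<0}"])
        (use 1 in \<open>auto simp: flat_def\<close>)
  next
    case 2
    have "flat n y / y = flat (Suc n) y" for y
      by (simp add: flat_def field_simps)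
    moreover have "flat m 0 = 0" for m
      by (simp add: flat_def)
    ultimately show ?thesis using 2 flat_tendsto_0[of "Suc n"]
      by (simp add: has_field_derivative_iff)
  next
    case 3
    have eq: "real n * inverse t ^ (n - 1) * (inverse t * inverse t) = real n * (inverse t ^ n * inverse t)"
      by (cases n) auto
    have "((\<lambda>x. inverse x ^ n * exp (- inverse x)) has_field_derivative
        (inverse t ^ n * (inverse t * inverse t) * exp (- inverse t)
         - real n * inverse t ^ (n - 1) * (inverse t * inverse t) * exp (- inverse t))) (at t)"
      using 3 by (auto intro!: derivative_eq_intros simp: power2_eq_square algebra_simps)
    then have "((\<lambda>x. inverse x ^ n * exp (- inverse x)) has_field_derivative
        (flat (n + 2) t - real n * flat (n + 1) t)) (at t)"
      using 3 unfolding eq by (simp add: flat_def algebra_simps)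
    then show ?thesis
      by (rule has_field_derivative_transform_within_open[of _ _ _ "{0<..}"])
        (use 3 in \<open>auto simp: flat_def\<close>)
  qed
qed

lemma Ck_on_flat: "Ck_on k (flat n) UNIV"
proof (induction k arbitrary: n)
  case 0
  then show ?case
    using DERIV_continuous[OF flat_has_derivative] by (auto intro: continuous_at_imp_continuous_on)
next
  case (Suc k)
  show ?case
  proof (rule Ck_on_SucI)
    show "(flat n has_derivative (\<lambda>v. (flat (n + 2) t + (- real n) * flat (n + 1) t) * v)) (at t)" for t
      using flat_has_derivative[of n t] by (simp add: has_field_derivative_def)
    show "Ck_on k (\<lambda>t. (flat (n + 2) t + (- real n) * flat (n + 1) t) * v) UNIV" for v
      by (intro Ck_on_bilinear[OF bounded_bilinear_mult] Ck_on_add Ck_on_const Suc open_UNIV)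
  qed simp
qed

lemma flat_pos: "t > 0 \<Longrightarrow> flat n t > 0"
  and flat_nonneg: "flat n t \<ge> 0"
  and flat_eq_0: "t \<le> 0 \<Longrightarrow> flat n t = 0"
  by (auto simp: flat_def)

text \<open>A smooth plateau: with \<open>u = |y - x|\<^sup>2\<close> the quotient
  \<open>flat (r\<^sup>2 - u) / (flat (r\<^sup>2 - u) + flat (u - r\<^sup>2/4))\<close> vanishes for \<open>u \<ge> r\<^sup>2\<close>, equals one for
  \<open>u \<le> r\<^sup>2/4\<close>, and its denominator has no zero because the two summands never vanish together.\<close>

lemma smooth_bump:
  fixes x :: "'a::euclidean_space"
  assumes "r > 0"
  obtains \<phi> :: "'a \<Rightarrow> real" where "\<And>k. Ck_on k \<phi> UNIV"
    and "\<And>y. y \<notin> ball x r \<Longrightarrow> \<phi> y = 0" and "\<And>y. y \<in> ball x (r / 2) \<Longrightarrow> \<phi> y = 1"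
proof -
  define u where "u y = (y - x) \<bullet> (y - x)" for y
  define p where "p y = flat 0 (r\<^sup>2 + - u y)" for y
  define q where "q y = p y + flat 0 (u y + - (r\<^sup>2 / 4))" for y
  have u: "u y = (dist x y)\<^sup>2" for y
    by (metis u_def dist_commute dist_norm power2_norm_eq_inner)
  have Ck_u: "Ck_on k u UNIV" for k
  proof -
    have "Ck_on k (\<lambda>y. (y + - x) \<bullet> (y + - x)) UNIV"
      by (intro Ck_on_bilinear[OF bounded_bilinear_inner] Ck_on_add Ck_on_ident Ck_on_const open_UNIV)
    then show ?thesis by (simp add: u_def[abs_def])
  qed
  have Ck_p: "Ck_on k p UNIV" for k
    unfolding p_def
    by (intro Ck_on_compose[OF open_UNIV open_UNIV _ _ Ck_on_flat] Ck_on_add Ck_on_const open_UNIV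
      Ck_on_bounded_linear[OF bounded_linear_minus[OF bounded_linear_ident]] Ck_u) auto
  have Ck_q: "Ck_on k q UNIV" for k
    unfolding q_def
    by (intro Ck_on_add Ck_p Ck_on_compose[OF open_UNIV open_UNIV _ _ Ck_on_flat] Ck_on_const
      open_UNIV Ck_u) auto
  have q_pos: "q y > 0" for y
  proof (cases "u y < r\<^sup>2")
    case True
    then show ?thesis unfolding q_def p_def
      by (intro add_pos_nonneg[OF flat_pos flat_nonneg]) simp
  next
    case False
    moreover have "r\<^sup>2 > 0" using assms by simp
    ultimately have "u y + - (r\<^sup>2 / 4) > 0" by argo
    then show ?thesis unfolding q_def p_def
      by (intro add_nonneg_pos[OF flat_nonneg flat_pos])
  qed
  show ?thesis
  proof
    show "Ck_on k (\<lambda>y. p y * inverse (q y)) UNIV" for k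
      using q_pos
      by (intro Ck_on_bilinear[OF bounded_bilinear_mult] Ck_p
        Ck_on_compose[OF open_UNIV _ _ Ck_q Ck_on_inverse]) auto
    show "p y * inverse (q y) = 0" if "y \<notin> ball x r" for y
    proof -
      have "r\<^sup>2 \<le> (dist x y)\<^sup>2" using that assms by (intro power_mono) auto
      then show ?thesis by (simp add: p_def u flat_eq_0)
    qed
    show "p y * inverse (q y) = 1" if "y \<in> ball x (r / 2)" for y
    proof -
      have "(dist x y)\<^sup>2 \<le> (r / 2)\<^sup>2" using that by (intro power_mono) auto
      then have "p y = q y" by (simp add: q_def u flat_eq_0 power_divide)
      then show ?thesis using q_pos[of y] by simp
    qed
  qed
qed

section \<open>Globally defined functions with prescribed germs\<close>

lemma is_chart_inverse:
  assumes "is_chart c"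
  shows "y \<in> chart_image c \<Longrightarrow> chart_inv c y \<in> fst c"
    and "y \<in> chart_image c \<Longrightarrow> snd c (chart_inv c y) = y"
    and "m \<in> fst c \<Longrightarrow> snd c m \<in> chart_image c"
    and "m \<in> fst c \<Longrightarrow> chart_inv c (snd c m) = m"
    and "continuous_on (chart_image c) (chart_inv c)"
  using assms unfolding is_chart_def homeomorphism_def by (blast, blast, blast, blast, blast)

lemma overlap_eq:
  assumes "is_chart c"
  shows "overlap c d = chart_image c \<inter> chart_inv c -` fst d"
proof (intro equalityI subsetI)
  fix y assume "y \<in> overlap c d"
  then obtain m where m: "m \<in> fst c" "m \<in> fst d" "y = snd c m"
    by (auto simp: overlap_def)
  then show "y \<in> chart_image c \<inter> chart_inv c -` fst d"
    using is_chart_inverse(3,4)[OF assms m(1)] by simp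
next
  fix y assume y: "y \<in> chart_image c \<inter> chart_inv c -` fst d"
  then show "y \<in> overlap c d"
    using is_chart_inverse(1,2)[OF assms, of y] unfolding overlap_def
    by (intro image_eqI[of y "snd c" "chart_inv c y"]) auto
qed

lemma open_overlap:
  assumes "is_chart c" "is_chart d"
  shows "open (overlap c d)"
  using assms continuous_open_preimage[OF is_chart_inverse(5)[OF assms(1)], of "fst d"]
  by (simp add: overlap_eq is_chart_def)

text \<open>A smooth function that is supported in the ball of radius \<open>r\<close> inside a chart extends by zero
  to the whole manifold. The only points where smoothness could fail are those outside the chart;
  they have a neighbourhood on which the extension vanishes because the ball is compact and the
  manifold is Hausdorff, so that the image of the ball is closed.\<close>

lemma smooth_function_extend_by_zero:
  fixes A :: "('m::{t2_space, second_countable_topology}, 'n::finite) chart set"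
  assumes A: "smooth_atlas A" and c: "c \<in> A"
    and r: "cball x r \<subseteq> chart_image c"
    and g: "\<And>k. Ck_on k g UNIV" "\<And>y. y \<notin> ball x r \<Longrightarrow> g y = (0::real)"
  shows "smooth_function A (\<lambda>m. if m \<in> fst c then g (snd c m) else 0)" (is "smooth_function A ?F")
  unfolding smooth_function_def smooth_on_def
proof (intro ballI allI)
  fix d k assume d: "d \<in> A"
  have ch: "is_chart c" "is_chart d"
    using A c d by (auto simp: smooth_atlas_def)
  define K where "K = chart_inv c ` cball x r"
  have "compact K" unfolding K_def
    by (intro compact_continuous_image continuous_on_subset[OF is_chart_inverse(5)[OF ch(1)]] r compact_cball)
  then have K: "closed K" by (rule compact_imp_closed)
  show "Ck_on k (local_rep ?F d) (chart_image d)"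
  proof (rule Ck_on_local)
    fix y assume y: "y \<in> chart_image d"
    show "\<exists>U. open U \<and> y \<in> U \<and> Ck_on k (local_rep ?F d) U"
    proof (cases "chart_inv d y \<in> fst c")
      case True
      have "Ck_on k (transition d c) (overlap d c)"
        using A c d unfolding smooth_atlas_def smooth_on_def by blast
      then have "Ck_on k (\<lambda>z. g (transition d c z)) (overlap d c)"
        by (intro Ck_on_compose[OF open_overlap[OF ch(2,1)] open_UNIV _ _ g(1)]) auto
      moreover have "local_rep ?F d z = g (transition d c z)" if "z \<in> overlap d c" for z
        using that by (simp add: overlap_eq[OF ch(2)] local_rep_def transition_def)
      ultimately have "Ck_on k (local_rep ?F d) (overlap d c)"
        using Ck_on_cong[OF open_overlap[OF ch(2,1)], of "local_rep ?F d"] by simp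
      then show ?thesis
        using True y open_overlap[OF ch(2,1)] unfolding overlap_eq[OF ch(2)] by blast
    next
      case False
      let ?U = "chart_image d \<inter> chart_inv d -` (- K)"
      have U: "open ?U"
        by (rule continuous_open_preimage[OF is_chart_inverse(5)[OF ch(2)]])
          (use ch(2) K in \<open>simp_all add: is_chart_def open_Compl\<close>)
      have "K \<subseteq> fst c"
        unfolding K_def by (intro image_subsetI is_chart_inverse(1)[OF ch(1)] subsetD[OF r])
      then have "chart_inv d y \<notin> K" using False by (rule contra_subsetD)
      moreover have "local_rep ?F d z = 0" if "z \<in> ?U" for z
      proof (rule ccontr)
        assume *: "local_rep ?F d z \<noteq> 0"
        then have m: "chart_inv d z \<in> fst c" "g (snd c (chart_inv d z)) \<noteq> 0"
          by (auto simp: local_rep_def split: if_splits)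
        then have "snd c (chart_inv d z) \<in> cball x r"
          using g(2)[of "snd c (chart_inv d z)"] by (cases "snd c (chart_inv d z) \<in> ball x r") auto
        then have "chart_inv d z \<in> K"
          unfolding K_def using is_chart_inverse(4)[OF ch(1) m(1)] by (metis imageI)
        then show False using that by auto
      qed
      then have "Ck_on k (local_rep ?F d) ?U"
        using Ck_on_cong[OF U, of "local_rep ?F d" "\<lambda>_. 0" k] Ck_on_const[of k 0 ?U] by simp
      ultimately show ?thesis using U y by blast
    qed
  qed
qed

text \<open>The identities defining the structures are only assumed for global objects. Multiplying a
  coordinate by a plateau function yields a global function that agrees with the coordinate near
  the given point, and this is enough test functions to recover every local identity.\<close>

lemma coordinate_function_exists:
  fixes A :: "('m::{t2_space, second_countable_topology}, 'n::finite) chart set"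
  assumes A: "smooth_atlas A" and c: "c \<in> A" and x: "x \<in> chart_image c"
  obtains F where "smooth_function A F"
    and "eventually (\<lambda>y. local_rep F c y = y $ i) (nhds x)"
proof -
  have ch: "is_chart c" using A c by (auto simp: smooth_atlas_def)
  then obtain r where r: "r > 0" "cball x r \<subseteq> chart_image c"
    using x unfolding is_chart_def open_contains_cball by blast
  obtain \<phi> :: "real ^ 'n \<Rightarrow> real" where \<phi>: "\<And>k. Ck_on k \<phi> UNIV"
    "\<And>y. y \<notin> ball x r \<Longrightarrow> \<phi> y = 0" "\<And>y. y \<in> ball x (r / 2) \<Longrightarrow> \<phi> y = 1"
    using smooth_bump[OF r(1), of x] by blast
  define g where "g y = \<phi> y * (y $ i)" for y
  let ?F = "\<lambda>m. if m \<in> fst c then g (snd c m) else 0"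
  show ?thesis
  proof
    have "Ck_on k g UNIV" for k
      unfolding g_def
      by (intro Ck_on_bilinear[OF bounded_bilinear_mult] \<phi> Ck_on_ident
        Ck_on_bounded_linear[OF bounded_linear_vec_nth] open_UNIV)
    then show "smooth_function A ?F"
      by (rule smooth_function_extend_by_zero[OF A c r(2)]) (simp add: g_def \<phi>)
    have "\<forall>\<^sub>F y in nhds x. y \<in> ball x (r / 2)"
      using r(1) by (intro eventually_nhds_in_open) auto
    then show "\<forall>\<^sub>F y in nhds x. local_rep ?F c y = y $ i"
    proof eventually_elim
      case (elim y)
      then have "y \<in> chart_image c" using r by (auto simp: subset_iff)
      then show ?case using elim is_chart_inverse[OF ch] by (simp add: local_rep_def g_def \<phi>)
    qed
  qed
qed

lemma linear_expand_axis:
  fixes f :: "real ^ 'n::finite \<Rightarrow> 'b::real_vector"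
  assumes "linear f"
  shows "f v = (\<Sum>i\<in>UNIV. v $ i *\<^sub>R f (axis i 1))"
proof -
  have "v = (\<Sum>i\<in>UNIV. v $ i *\<^sub>R axis i 1)"
    by (simp add: vec_eq_iff sum_component axis_def if_distrib cong: if_cong)
  then have "f v = f (\<Sum>i\<in>UNIV. v $ i *\<^sub>R axis i 1)" by (rule arg_cong)
  then show ?thesis using assms by (simp add: linear_sum linear_scale)
qed

lemma d_fun_inner:
  assumes "f differentiable at x"
  shows "d_fun f x \<bullet> v = frechet_derivative f (at x) v"
proof -
  have lin: "linear (frechet_derivative f (at x))"
    using assms by (simp add: linear_frechet_derivative)
  show ?thesis
    by (simp add: linear_expand_axis[OF lin, of v] d_fun_def inner_vec_def mult.commute)
qed

lemma one_form_differential: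
  fixes A :: "('m::{t2_space, second_countable_topology}, 'n::finite) chart set"
  assumes A: "smooth_atlas A" and F: "smooth_function A F"
  shows "one_form A (\<lambda>c. d_fun (local_rep F c))"
  unfolding one_form_def
proof (intro conjI ballI)
  fix c assume c: "c \<in> A"
  have "Ck_on k (d_fun (local_rep F c)) (chart_image c)" for k
  proof (rule Ck_on_vec)
    show "open (chart_image c)" using A c by (auto simp: smooth_atlas_def is_chart_def)
    show "Ck_on k (\<lambda>x. d_fun (local_rep F c) x $ i) (chart_image c)" for i
    proof -
      have "Ck_on (Suc k) (local_rep F c) (chart_image c)"
        using F c unfolding smooth_function_def smooth_on_def by blast
      then show ?thesis by (simp add: d_fun_def)
    qed
  qed
  then show "smooth_on (d_fun (local_rep F c)) (chart_image c)" by (simp add: smooth_on_def)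
next
  fix c d y assume c: "c \<in> A" and d: "d \<in> A" and y: "y \<in> overlap c d"
  let ?t = "transition c d"
  have ch: "is_chart c" "is_chart d" using A c d by (auto simp: smooth_atlas_def)
  have "Ck_on (Suc 0) ?t (overlap c d)"
    using A c d unfolding smooth_atlas_def smooth_on_def by blast
  then have t': "?t differentiable at y" using y by simp
  have ty: "?t y \<in> chart_image d"
    using y is_chart_inverse(3)[OF ch(2)] by (auto simp: overlap_eq[OF ch(1)] transition_def)
  have "Ck_on (Suc 0) (local_rep F d) (chart_image d)"
    using F d unfolding smooth_function_def smooth_on_def by blast
  then have Fd: "local_rep F d differentiable at (?t y)" using ty by simp
  have "(local_rep F d \<circ> ?t) z = local_rep F c z" if "z \<in> overlap c d" for z
    using that is_chart_inverse(4)[OF ch(2)]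
    by (auto simp: overlap_eq[OF ch(1)] transition_def local_rep_def)
  then have "frechet_derivative (local_rep F c) (at y) = frechet_derivative (local_rep F d \<circ> ?t) (at y)"
    by (rule frechet_derivative_transform_within_open[OF differentiable_chain_at[OF t' Fd]
      open_overlap[OF ch] y, symmetric])
  also have "\<dots> = frechet_derivative (local_rep F d) (at (?t y)) \<circ> frechet_derivative ?t (at y)"
    by (rule frechet_derivative_compose[OF t' Fd])
  finally have "d_fun (local_rep F c) y $ i
      = d_fun (local_rep F d) (?t y) \<bullet> frechet_derivative ?t (at y) (axis i 1)" for i
    using d_fun_inner[OF Fd] by (simp add: d_fun_def[of "local_rep F c"])
  then show "d_fun (local_rep F c) y = transpose (jacobian ?t (at y)) *v d_fun (local_rep F d) (?t y)"
    by (simp add: vec_eq_iff matrix_vector_mult_def transpose_def jacobian_def matrix_def inner_vec_def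
      mult.commute)
qed

lemma d_fun_coordinate:
  assumes "eventually (\<lambda>y. f y = y $ i) (nhds x)"
  shows "eventually (\<lambda>y. d_fun f y = axis i 1) (nhds x)"
  using assms unfolding eventually_nhds
proof (elim exE conjE, intro exI conjI ballI)
  fix S y assume S: "open S" "\<forall>y\<in>S. f y = y $ i" and y: "y \<in> S"
  have "((\<lambda>y. y $ i) has_derivative (\<lambda>v. v $ i)) (at y)"
    by (intro bounded_linear_imp_has_derivative bounded_linear_vec_nth)
  then have "(f has_derivative (\<lambda>v. v $ i)) (at y)"
    by (rule has_derivative_transform_within_open[OF _ S(1) y]) (use S in auto)
  from frechet_derivative_at[OF this, symmetric] show "d_fun f y = axis i 1"
    by (simp add: d_fun_def vec_eq_iff axis_def)
qed

section \<open>Derivatives of matrix expressions\<close>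

lemma bounded_bilinear_matrix_matrix_mult:
  "bounded_bilinear ((**) :: real ^ 'n::finite ^ 'm::finite \<Rightarrow> real ^ 'p::finite ^ 'n \<Rightarrow> _)"
  by (simp add: bilinear_def linear_iff matrix_matrix_mult_def vec_eq_iff algebra_simps
      sum.distrib sum_distrib_left flip: bilinear_conv_bounded_bilinear)

lemma bounded_bilinear_matrix_vector_mult:
  "bounded_bilinear ((*v) :: real ^ 'n::finite ^ 'm::finite \<Rightarrow> real ^ 'n \<Rightarrow> _)"
  by (simp add: bilinear_def linear_iff matrix_vector_mult_def vec_eq_iff algebra_simps
      sum.distrib sum_distrib_left flip: bilinear_conv_bounded_bilinear)

lemma bounded_linear_transpose:
  "bounded_linear (transpose :: real ^ 'n::finite ^ 'm::finite \<Rightarrow> _)"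
  by (simp add: linear_iff transpose_def vec_eq_iff flip: linear_conv_bounded_linear)

lemma bounded_linear_trace: "bounded_linear (trace :: real ^ 'n::finite ^ 'n \<Rightarrow> real)"
  by (simp add: linear_iff trace_def sum.distrib sum_distrib_left flip: linear_conv_bounded_linear)

lemmas has_derivative_matrix_matrix_mult = bounded_bilinear.FDERIV[OF bounded_bilinear_matrix_matrix_mult]
lemmas has_derivative_matrix_vector_mult = bounded_bilinear.FDERIV[OF bounded_bilinear_matrix_vector_mult]
lemmas has_derivative_transpose = bounded_linear.has_derivative[OF bounded_linear_transpose]

lemma matrix_mult_axis: "(A *v axis j (1::real)) $ i = A $ i $ j"
  by (simp add: matrix_vector_mult_def axis_def if_distrib cong: if_cong)

lemma mpow_0 [simp]: "mpow B 0 = mat 1"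
  and mpow_Suc [simp]: "mpow B (Suc k) = B ** mpow B k"
  by (simp_all add: mpow_def)

lemma mpow_commute: "mpow B k ** B = B ** mpow B k"
  by (induction k) (simp_all flip: matrix_mul_assoc)

lemma mpow_intertwine:
  assumes "B ** P = P ** transpose B"
  shows "mpow B k ** P = P ** transpose (mpow B k)"
proof (induction k)
  case (Suc k)
  have "B ** mpow B k ** P = B ** P ** transpose (mpow B k)"
    by (simp add: Suc flip: matrix_mul_assoc)
  also have "\<dots> = P ** transpose (mpow B k ** B)"
    by (simp add: assms matrix_transpose_mul matrix_mul_assoc)
  finally show ?case by (simp add: mpow_commute)
qed simp

text \<open>The derivative of a matrix power is a sum of products in which the factors do not commute.
  Under the trace, and against a matrix that commutes with the base point, all these products
  contribute equally. The extra factor \<open>N x\<close> avoids the exponent \<open>k - 1\<close> in the induction.\<close>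

lemma mpow_has_derivative_trace:
  fixes N :: "'a::real_normed_vector \<Rightarrow> real ^ 'n::finite ^ 'n"
  assumes N': "(N has_derivative N') (at x)"
  shows "\<exists>D. ((\<lambda>y. mpow (N y) k) has_derivative D) (at x) \<and>
    (\<forall>C h. C ** N x = N x ** C \<longrightarrow>
      trace (C ** (N x ** D h)) = real k * trace (C ** (mpow (N x) k ** N' h)))"
proof (induction k)
  case 0
  have "((\<lambda>y. mat 1) has_derivative (\<lambda>h. 0)) (at x)" by simp
  moreover have "A ** 0 = (0 :: real ^ 'n ^ 'n)" for A :: "real ^ 'n ^ 'n"
    by (simp add: bounded_bilinear.zero_right[OF bounded_bilinear_matrix_matrix_mult])
  ultimately show ?case by (intro exI[of _ "\<lambda>h. 0"]) (simp add: trace_def)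
next
  case (Suc k)
  then obtain D where D: "((\<lambda>y. mpow (N y) k) has_derivative D) (at x)"
    and tr: "\<And>C h. C ** N x = N x ** C \<Longrightarrow>
      trace (C ** (N x ** D h)) = real k * trace (C ** (mpow (N x) k ** N' h))"
    by blast
  let ?D = "\<lambda>h. N x ** D h + N' h ** mpow (N x) k"
  have "((\<lambda>y. mpow (N y) (Suc k)) has_derivative ?D) (at x)"
    using has_derivative_matrix_matrix_mult[OF N' D] by simp
  moreover have "trace (C ** (N x ** ?D h)) = real (Suc k) * trace (C ** (mpow (N x) (Suc k) ** N' h))"
    if C: "C ** N x = N x ** C" for C h
  proof -
    have CN: "(C ** N x) ** N x = N x ** (C ** N x)"
      by (subst C) (simp only: matrix_mul_assoc)
    have CM: "C ** mpow (N x) m = mpow (N x) m ** C" for m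
    proof (induction m)
      case (Suc m)
      have "C ** (N x ** mpow (N x) m) = N x ** (C ** mpow (N x) m)"
        by (simp add: C matrix_mul_assoc)
      then show ?case by (simp add: Suc matrix_mul_assoc)
    qed simp
    have "trace (C ** (N x ** (N' h ** mpow (N x) k))) = trace ((C ** N x ** N' h) ** mpow (N x) k)"
      by (simp add: matrix_mul_assoc)
    also have "\<dots> = trace (mpow (N x) k ** C ** N x ** N' h)"
      by (subst trace_mul_sym) (simp add: matrix_mul_assoc)
    also have "mpow (N x) k ** C ** N x = C ** mpow (N x) (Suc k)"
    proof -
      have "mpow (N x) k ** C ** N x = mpow (N x) k ** N x ** C"
        by (simp add: C flip: matrix_mul_assoc)
      then show ?thesis by (simp only: mpow_commute mpow_Suc[symmetric] CM)
    qed
    finally have "trace (C ** (N x ** (N' h ** mpow (N x) k)))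
        = trace (C ** (mpow (N x) (Suc k) ** N' h))"
      by (simp add: matrix_mul_assoc)
    moreover have "trace (C ** (N x ** (N x ** D h)))
        = real k * trace (C ** (mpow (N x) (Suc k) ** N' h))"
      using tr[OF CN, of h] by (simp add: matrix_mul_assoc)
    ultimately show ?thesis
      by (simp add: matrix_add_ldistrib trace_add algebra_simps)
  qed
  ultimately show ?case by blast
qed

lemma trace_mpow_has_derivative:
  fixes N :: "'a::real_normed_vector \<Rightarrow> real ^ 'n::finite ^ 'n"
  assumes N': "(N has_derivative N') (at x)"
  shows "((\<lambda>y. trace (mpow (N y) (Suc k))) has_derivative
    (\<lambda>h. real (Suc k) * trace (mpow (N x) k ** N' h))) (at x)"
proof -
  obtain D where D: "((\<lambda>y. mpow (N y) k) has_derivative D) (at x)"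
    and tr: "\<And>C h. C ** N x = N x ** C \<Longrightarrow>
      trace (C ** (N x ** D h)) = real k * trace (C ** (mpow (N x) k ** N' h))"
    using mpow_has_derivative_trace[OF N', of k] by blast
  have "((\<lambda>y. trace (mpow (N y) (Suc k))) has_derivative
      (\<lambda>h. trace (N x ** D h + N' h ** mpow (N x) k))) (at x)"
    using bounded_linear.has_derivative[OF bounded_linear_trace has_derivative_matrix_matrix_mult[OF N' D]]
    by simp
  moreover have "trace (N x ** D h + N' h ** mpow (N x) k)
      = real (Suc k) * trace (mpow (N x) k ** N' h)" for h
    using tr[of "mat 1" h] trace_mul_sym[of "N' h" "mpow (N x) k"]
    by (simp add: trace_add algebra_simps)
  ultimately show ?thesis by simp
qed


section \<open>The divergence of a hamiltonian field\<close>

text \<open>A derivation of the arguments acts on a form of top degree by its trace. If \<open>\<omega> v \<noteq> 0\<close>, the rows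
  of \<open>v\<close> are independent; in the basis that they form, \<open>A\<close> has a matrix similar to its transpose,
  and by alternation only its diagonal entries survive.\<close>

lemma alternating_form_trace:
  fixes A v :: "real ^ 'n::finite ^ 'n"
  assumes \<omega>: "alternating_form \<omega>" and nz: "\<omega> v \<noteq> 0"
  shows "(\<Sum>i\<in>UNIV. \<omega> (\<chi> j. if j = i then A *v (v $ j) else v $ j)) = trace A * \<omega> v"
proof -
  define up where "up i u = (\<chi> j. if j = i then u else v $ j)" for i u
  have lin: "linear (\<lambda>u. \<omega> (up i u))" for i
    using \<omega> by (simp add: alternating_form_def up_def)
  have row: "\<omega> (up i (v $ m)) = (if m = i then \<omega> v else 0)" for i m
  proof (cases "m = i")
    case True
    then have "up i (v $ m) = v" by (simp add: up_def vec_eq_iff)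
    then show ?thesis using True by simp
  next
    case False
    have "up i (v $ m) $ i = up i (v $ m) $ m" using False by (simp add: up_def)
    then show ?thesis using False \<omega> unfolding alternating_form_def by metis
  qed
  have comb: "\<omega> (up i (\<Sum>m\<in>UNIV. b m *\<^sub>R v $ m)) = b i * \<omega> v" for i b
    using lin[of i] by (simp add: linear_sum[of "\<lambda>u. \<omega> (up i u)"] linear_scale[of "\<lambda>u. \<omega> (up i u)"] row
      if_distrib cong: if_cong)
  have "\<exists>w. v ** w = mat 1"
    unfolding matrix_right_invertible_independent_rows
  proof (intro allI impI)
    fix b i assume "(\<Sum>i\<in>UNIV. b i *s row i v) = 0"
    then have "(\<Sum>i\<in>UNIV. b i *\<^sub>R v $ i) = 0"
      by (simp add: row_def scalar_mult_eq_scaleR)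
    then have "b i * \<omega> v = \<omega> (up i 0)" using comb[of i b] by simp
    also have "\<dots> = 0" using linear_0[OF lin] by simp
    finally show "b i = 0" using nz by simp
  qed
  then obtain w where w: "v ** w = mat 1" by blast
  then have wv: "w ** v = mat 1" by (simp add: matrix_left_right_inverse)
  \<comment> \<open>The matrix of \<open>A\<close> in the basis of the rows of \<open>v\<close>.\<close>
  define B where "B = v ** transpose A ** w"
  have Bv: "A *v (v $ i) = (\<Sum>m\<in>UNIV. B $ i $ m *\<^sub>R v $ m)" for i
  proof -
    have "B ** v = v ** transpose A"
      by (simp add: B_def wv flip: matrix_mul_assoc)
    then have "(B ** v) $ i = (v ** transpose A) $ i" by simp
    then show ?thesis
      by (simp add: vec_eq_iff matrix_matrix_mult_def matrix_vector_mult_def transpose_def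
        sum_component mult.commute)
  qed
  have "(\<Sum>i\<in>UNIV. \<omega> (\<chi> j. if j = i then A *v (v $ j) else v $ j)) = (\<Sum>i\<in>UNIV. \<omega> (up i (A *v (v $ i))))"
    unfolding up_def by (intro sum.cong arg_cong[of _ _ \<omega>]) (simp_all add: vec_eq_iff)
  also have "\<dots> = (\<Sum>i\<in>UNIV. B $ i $ i * \<omega> v)"
    by (simp add: Bv comb)
  also have "\<dots> = trace B * \<omega> v"
    by (simp add: trace_def sum_distrib_right)
  also have "trace B = trace (transpose A)"
    unfolding B_def by (subst trace_mul_sym) (simp add: wv matrix_mul_assoc)
  also have "\<dots> = trace A"
    by (simp add: trace_def transpose_def)
  finally show ?thesis .
qed

lemma lie_top_form_ham_coordinate:
  fixes Q :: "real ^ 'n::finite \<Rightarrow> real ^ 'n ^ 'n"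
  assumes f: "eventually (\<lambda>y. f y = y $ b) (nhds x)"
    and Q': "(Q has_derivative Q') (at x)"
    and \<mu>: "alternating_form (\<mu> x)" "\<mu> x v \<noteq> 0"
  shows "lie_top_form (ham Q f) \<mu> x v = frechet_derivative (\<lambda>y. \<mu> y v) (at x) (Q x *v axis b 1)
    + (\<Sum>m\<in>UNIV. Q' (axis m 1) $ m $ b) * \<mu> x v"
proof -
  have ev: "\<forall>\<^sub>F y in nhds x. ham Q f y = Q y *v axis b 1"
    using d_fun_coordinate[OF f] by eventually_elim (simp add: ham_def)
  then obtain S where S: "open S" "x \<in> S" "\<And>y. y \<in> S \<Longrightarrow> ham Q f y = Q y *v axis b 1"
    unfolding eventually_nhds by blast
  have "((\<lambda>y. Q y *v axis b 1) has_derivative (\<lambda>h. Q' h *v axis b 1)) (at x)"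
    using has_derivative_matrix_vector_mult[OF Q' has_derivative_const[of "axis b 1"]]
    by (simp add: matrix_vector_mult_0_right)
  then have "(ham Q f has_derivative (\<lambda>h. Q' h *v axis b 1)) (at x)"
    by (rule has_derivative_transform_within_open[OF _ S(1,2)]) (simp add: S(3))
  from frechet_derivative_at[OF this] has_derivative_linear[OF this]
  have D: "frechet_derivative (ham Q f) (at x) = (\<lambda>h. Q' h *v axis b 1)"
    and lin: "linear (\<lambda>h. Q' h *v axis b 1)" by simp_all
  let ?A = "matrix (\<lambda>h. Q' h *v axis b 1)"
  have A: "?A *v h = Q' h *v axis b 1" for h
    by (rule fun_cong[OF matrix_vector_mul(2)[OF lin]])
  have "lie_top_form (ham Q f) \<mu> x v = frechet_derivative (\<lambda>y. \<mu> y v) (at x) (Q x *v axis b 1)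
      + trace ?A * \<mu> x v"
    unfolding lie_top_form_def D alternating_form_trace[OF \<mu>, symmetric]
    using S(2,3) by (simp add: A cong: if_cong)
  then show ?thesis by (simp add: trace_def matrix_def matrix_mult_axis)
qed

text \<open>In coordinates the modular field of \<open>Q\<close> has the components
  \<open>\<partial>\<^sub>i Q\<^sub>i\<^sub>j - Q\<^sub>j\<^sub>i \<partial>\<^sub>i log m\<close>, where \<open>m\<close> is the density of the volume form. The numbers
  \<open>L u\<close> and \<open>\<omega>\<close> are the derivative along \<open>u\<close> and the value of the form on a fixed frame. Since \<open>N Q = Q N\<^sup>t\<close>, the terms with the derivative of the volume form cancel in the
  difference, and so do those with the derivative of \<open>Q\<close>; only a derivative of \<open>N\<close> is left.\<close>

lemma modular_difference:
  fixes Q N :: "real ^ 'n::finite ^ 'n" and Q' N' :: "'n \<Rightarrow> real ^ 'n ^ 'n"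
  assumes "linear L" and nz: "\<omega> \<noteq> (0::real)"
    and X: "\<And>l. X $ l * \<omega> = L (Q *v axis l 1) + (\<Sum>m\<in>UNIV. Q' m $ m $ l) * \<omega>"
    and Y: "\<And>l. Y $ l * \<omega> = L ((Q ** transpose N) *v axis l 1)
      + (\<Sum>m\<in>UNIV. (Q ** transpose (N' m) + Q' m ** transpose N) $ m $ l) * \<omega>"
  shows "(Y - N *v X) $ b = (\<Sum>m\<in>UNIV. \<Sum>l\<in>UNIV. Q $ m $ l * N' m $ b $ l)"
proof -
  have "(Q ** transpose N) *v axis b 1 = (\<Sum>l\<in>UNIV. N $ b $ l *\<^sub>R (Q *v axis l 1))"
    by (simp add: vec_eq_iff sum_component matrix_mult_axis)
      (simp add: matrix_matrix_mult_def transpose_def mult.commute)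
  then have L: "L ((Q ** transpose N) *v axis b 1) = (\<Sum>l\<in>UNIV. N $ b $ l * L (Q *v axis l 1))"
    using \<open>linear L\<close> by (simp add: linear_sum linear_scale)
  have "(N *v X) $ b * \<omega> = (\<Sum>l\<in>UNIV. N $ b $ l * (X $ l * \<omega>))"
    by (simp add: matrix_vector_mult_def sum_distrib_right mult.assoc)
  also have "\<dots> = (\<Sum>l\<in>UNIV. N $ b $ l * L (Q *v axis l 1))
      + (\<Sum>l\<in>UNIV. N $ b $ l * (\<Sum>m\<in>UNIV. Q' m $ m $ l)) * \<omega>"
    unfolding X by (simp add: distrib_left sum.distrib sum_distrib_right mult.assoc)
  also have "(\<Sum>l\<in>UNIV. N $ b $ l * (\<Sum>m\<in>UNIV. Q' m $ m $ l))
      = (\<Sum>m\<in>UNIV. (Q' m ** transpose N) $ m $ b)"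
    by (simp add: matrix_matrix_mult_def transpose_def sum_distrib_left mult.commute)
      (rule sum.swap)
  finally have "(Y - N *v X) $ b * \<omega> = (\<Sum>m\<in>UNIV. (Q ** transpose (N' m)) $ m $ b) * \<omega>"
    using Y[of b] L by (simp add: sum.distrib algebra_simps)
  then show ?thesis using nz by (simp add: matrix_matrix_mult_def transpose_def)
qed


section \<open>The compatibility condition in coordinates\<close>

lemma form_bracket_component:
  fixes Q :: "real ^ 'n::finite \<Rightarrow> real ^ 'n ^ 'n"
  assumes skew: "transpose (Q x) = - Q x"
    and Q': "(Q has_derivative Q') (at x)"
    and \<alpha>': "(\<alpha> has_derivative \<alpha>') (at x)" and \<beta>': "(\<beta> has_derivative \<beta>') (at x)"
  shows "form_bracket Q \<alpha> \<beta> x $ j = \<beta>' (Q x *v \<alpha> x) $ j - \<alpha>' (Q x *v \<beta> x) $ j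
    - \<alpha> x \<bullet> (Q' (axis j 1) *v \<beta> x)"
proof -
  have Q\<alpha>: "((\<lambda>y. Q y *v \<alpha> y) has_derivative (\<lambda>h. Q x *v \<alpha>' h + Q' h *v \<alpha> x)) (at x)"
    and Q\<beta>: "((\<lambda>y. Q y *v \<beta> y) has_derivative (\<lambda>h. Q x *v \<beta>' h + Q' h *v \<beta> x)) (at x)"
    by (intro has_derivative_matrix_vector_mult Q' \<alpha>' \<beta>')+
  note Q\<alpha>\<beta> = has_derivative_inner[OF Q\<alpha> \<beta>']
  have adj: "(Q x *v u) \<bullet> w = - (u \<bullet> (Q x *v w))" for u w
  proof -
    have "(Q x *v u) \<bullet> w = u \<bullet> (transpose (Q x) *v w)"
      unfolding transpose_matrix_vector inner_commute[of u] dot_lmul_matrix by (rule inner_commute)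
    then show ?thesis unfolding skew by (simp add: bounded_bilinear.minus_left[OF bounded_bilinear_matrix_vector_mult])
  qed
  show ?thesis
    unfolding form_bracket_def lie_one_form_def d_fun_def
      frechet_derivative_at[OF Q\<alpha>, symmetric] frechet_derivative_at[OF Q\<beta>, symmetric]
      frechet_derivative_at[OF Q\<alpha>\<beta>, symmetric] frechet_derivative_at[OF \<alpha>', symmetric]
      frechet_derivative_at[OF \<beta>', symmetric]
    by (simp add: inner_add_right adj inner_commute[of _ "\<alpha> x"] inner_commute[of _ "\<beta> x"])
qed

text \<open>Evaluated on two differentials of coordinates, the compatibility condition becomes the
  vanishing of the components of the Magri-Morosi concomitant.\<close>

lemma concomitant_in_coordinates:
  fixes P N :: "real ^ 'n::finite \<Rightarrow> real ^ 'n ^ 'n"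
  assumes skew: "transpose (P x) = - P x"
    and NP: "N x ** P x = P x ** transpose (N x)"
    and P': "(P has_derivative P') (at x)" and N': "(N has_derivative N') (at x)"
    and \<alpha>: "eventually (\<lambda>y. \<alpha> y = axis a 1) (nhds x)"
    and \<beta>: "eventually (\<lambda>y. \<beta> y = axis b 1) (nhds x)"
    and br: "form_bracket (\<lambda>y. N y ** P y) \<alpha> \<beta> x =
            form_bracket P (\<lambda>y. transpose (N y) *v \<alpha> y) \<beta> x +
            form_bracket P \<alpha> (\<lambda>y. transpose (N y) *v \<beta> y) x -
            transpose (N x) *v form_bracket P \<alpha> \<beta> x"
  shows "(N' (axis j 1) ** P x) $ a $ b =
      (\<Sum>m\<in>UNIV. P x $ m $ b * N' (axis m 1) $ a $ j) - (\<Sum>m\<in>UNIV. P x $ m $ a * N' (axis m 1) $ b $ j)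
      + (P' (axis j 1) ** transpose (N x)) $ a $ b - (\<Sum>l\<in>UNIV. N x $ l $ j * P' (axis l 1) $ a $ b)"
proof -
  have const: "(\<gamma> has_derivative (\<lambda>h. 0)) (at x)" "\<gamma> x = axis i 1"
    if "eventually (\<lambda>y. \<gamma> y = axis i 1) (nhds x)" for \<gamma> :: "real ^ 'n \<Rightarrow> real ^ 'n" and i
  proof -
    show x: "\<gamma> x = axis i 1" using that by (rule eventually_nhds_x_imp_x)
    have "\<forall>\<^sub>F y in at x. axis i 1 = \<gamma> y"
      using that unfolding eventually_nhds_conv_at by (auto elim: eventually_mono)
    then show "(\<gamma> has_derivative (\<lambda>h. 0)) (at x)"
      by (rule has_derivative_transform_eventually[OF has_derivative_const]) (simp_all add: x)
  qed
  note \<alpha>' = const(1)[OF \<alpha>] and \<alpha>x = const(2)[OF \<alpha>] and \<beta>' = const(1)[OF \<beta>] and \<beta>x = const(2)[OF \<beta>]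
  have skewN: "transpose (N x ** P x) = - (N x ** P x)"
  proof -
    have "transpose (N x ** P x) = (- P x) ** transpose (N x)"
      by (simp add: matrix_transpose_mul skew)
    also have "\<dots> = - (P x ** transpose (N x))"
      by (rule bounded_bilinear.minus_left[OF bounded_bilinear_matrix_matrix_mult])
    finally show ?thesis by (simp only: NP)
  qed
  have NPd: "((\<lambda>y. N y ** P y) has_derivative (\<lambda>h. N x ** P' h + N' h ** P x)) (at x)"
    by (rule has_derivative_matrix_matrix_mult[OF N' P'])
  have N\<alpha>: "((\<lambda>y. transpose (N y) *v \<alpha> y) has_derivative
      (\<lambda>h. transpose (N x) *v 0 + transpose (N' h) *v \<alpha> x)) (at x)"
    and N\<beta>: "((\<lambda>y. transpose (N y) *v \<beta> y) has_derivative
      (\<lambda>h. transpose (N x) *v 0 + transpose (N' h) *v \<beta> x)) (at x)"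
    by (intro has_derivative_matrix_vector_mult has_derivative_transpose N' \<alpha>' \<beta>')+
  have ax: "axis a 1 \<bullet> (A *v axis b 1) = A $ a $ b" for A :: "real ^ 'n ^ 'n"
    by (simp add: inner_axis' matrix_mult_axis)
  have tr: "(transpose A *v axis i 1) $ j = A $ i $ j" for A :: "real ^ 'n ^ 'n" and i
    by (simp add: matrix_mult_axis transpose_def del: transpose_matrix_vector)
  have trl: "(transpose A *v axis a 1) \<bullet> (B *v axis b 1) = (A ** B) $ a $ b"
    for A B :: "real ^ 'n ^ 'n"
    by (simp add: inner_vec_def matrix_mult_axis transpose_def matrix_matrix_mult_def
        del: transpose_matrix_vector)
  have trr: "axis a 1 \<bullet> (B *v (transpose A *v axis b 1)) = (B ** transpose A) $ a $ b"
    for A B :: "real ^ 'n ^ 'n"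
    unfolding matrix_vector_mul_assoc by (rule ax)
  \<comment> \<open>Derivatives along \<open>P dx\<^sub>i\<close> are expanded into partial derivatives.\<close>
  have exp: "N' (P x *v axis i 1) $ k $ j = (\<Sum>m\<in>UNIV. P x $ m $ i * N' (axis m 1) $ k $ j)" for i k
    by (subst linear_expand_axis[OF has_derivative_linear[OF N']])
      (simp add: sum_component matrix_mult_axis)
  have brP: "(transpose (N x) *v form_bracket P \<alpha> \<beta> x) $ j
      = - (\<Sum>l\<in>UNIV. N x $ l $ j * P' (axis l 1) $ a $ b)"
    unfolding matrix_vector_mult_def
    by (simp add: form_bracket_component[OF skew P' \<alpha>' \<beta>'] \<alpha>x \<beta>x ax transpose_def sum_negf)
  from arg_cong[OF br, of "\<lambda>v. v $ j"]
  have "- (N x ** P' (axis j 1) + N' (axis j 1) ** P x) $ a $ b =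
      - N' (P x *v axis b 1) $ a $ j - (N x ** P' (axis j 1)) $ a $ b
      + (N' (P x *v axis a 1) $ b $ j - (P' (axis j 1) ** transpose (N x)) $ a $ b)
      + (\<Sum>l\<in>UNIV. N x $ l $ j * P' (axis l 1) $ a $ b)"
    by (simp add: form_bracket_component[OF skewN NPd \<alpha>' \<beta>'] form_bracket_component[OF skew P' N\<alpha> \<beta>']
      form_bracket_component[OF skew P' \<alpha>' N\<beta>] brP \<alpha>x \<beta>x ax tr trl trr
      del: transpose_matrix_vector)
  then show ?thesis by (simp add: exp)
qed

lemma sum_rotate3:
  "(\<Sum>a\<in>A. \<Sum>j\<in>B. \<Sum>m\<in>C. f a j m) = (\<Sum>m\<in>C. \<Sum>j\<in>B. \<Sum>a\<in>A. f a j m)"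
proof -
  have "(\<Sum>a\<in>A. \<Sum>j\<in>B. \<Sum>m\<in>C. f a j m) = (\<Sum>a\<in>A. \<Sum>m\<in>C. \<Sum>j\<in>B. f a j m)"
    by (intro sum.cong refl sum.swap)
  also have "\<dots> = (\<Sum>m\<in>C. \<Sum>a\<in>A. \<Sum>j\<in>B. f a j m)" by (rule sum.swap)
  also have "\<dots> = (\<Sum>m\<in>C. \<Sum>j\<in>B. \<Sum>a\<in>A. f a j m)"
    by (intro sum.cong refl sum.swap)
  finally show ?thesis .
qed

text \<open>Contracting the concomitant with \<open>M\<close> over two of its indices gives, apart from terms with
  derivatives of \<open>P\<close>, the wanted trace and twice the field on the left: one copy stands in the
  concomitant itself, the other one appears when the derivative of \<open>N P = P N\<^sup>t\<close> is used to
  eliminate the derivatives of \<open>P\<close>.\<close>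

lemma contracted_concomitant:
  fixes P N M :: "real ^ 'n::finite ^ 'n" and dP dN :: "'n \<Rightarrow> real ^ 'n ^ 'n"
  assumes skew: "transpose P = - P"
    and MP: "M ** P = P ** transpose M" and MN: "M ** N = N ** M"
    and dNP: "\<And>j. N ** dP j + dN j ** P = P ** transpose (dN j) + dP j ** transpose N"
    and conc: "\<And>a j. (dN j ** P) $ a $ b =
      (\<Sum>m\<in>UNIV. P $ m $ b * dN m $ a $ j) - (\<Sum>m\<in>UNIV. P $ m $ a * dN m $ b $ j)
      + (dP j ** transpose N) $ a $ b - (\<Sum>l\<in>UNIV. N $ l $ j * dP l $ a $ b)"
  shows "(\<Sum>m\<in>UNIV. \<Sum>l\<in>UNIV. (M ** P) $ m $ l * dN m $ b $ l)
    = - (1 / 2) * (\<Sum>m\<in>UNIV. P $ b $ m * trace (M ** dN m))" (is "?Y = _")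
proof -
  \<comment> \<open>The contraction over the two indices that the concomitant leaves free besides \<open>b\<close>.\<close>
  define con where "con f = (\<Sum>a\<in>UNIV. \<Sum>j\<in>UNIV. M $ j $ a * f a j)" for f
  have con_add: "con (\<lambda>a j. f a j + g a j) = con f + con g"
    and con_diff: "con (\<lambda>a j. f a j - g a j) = con f - con g" for f g
    by (simp_all add: con_def algebra_simps sum.distrib sum_subtractf)
  have con_mult: "con (\<lambda>a j. (A ** B j) $ a $ b) = (\<Sum>j\<in>UNIV. \<Sum>l\<in>UNIV. (M ** A) $ j $ l * B j $ l $ b)"
    for A :: "real ^ 'n ^ 'n" and B :: "'n \<Rightarrow> real ^ 'n ^ 'n"
  proof -
    have "con (\<lambda>a j. (A ** B j) $ a $ b) = (\<Sum>a\<in>UNIV. \<Sum>j\<in>UNIV. \<Sum>l\<in>UNIV. M $ j $ a * A $ a $ l * B j $ l $ b)"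
      by (simp add: con_def matrix_matrix_mult_def sum_distrib_left mult.assoc)
    also have "\<dots> = (\<Sum>l\<in>UNIV. \<Sum>j\<in>UNIV. \<Sum>a\<in>UNIV. M $ j $ a * A $ a $ l * B j $ l $ b)"
      by (rule sum_rotate3)
    also have "\<dots> = (\<Sum>j\<in>UNIV. \<Sum>l\<in>UNIV. \<Sum>a\<in>UNIV. M $ j $ a * A $ a $ l * B j $ l $ b)"
      by (rule sum.swap)
    finally show ?thesis by (simp add: matrix_matrix_mult_def sum_distrib_right)
  qed
  have T2: "con (\<lambda>a j. \<Sum>m\<in>UNIV. P $ m $ b * dN m $ a $ j) = (\<Sum>m\<in>UNIV. P $ m $ b * trace (M ** dN m))"
  proof -
    have "con (\<lambda>a j. \<Sum>m\<in>UNIV. P $ m $ b * dN m $ a $ j)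
        = (\<Sum>a\<in>UNIV. \<Sum>j\<in>UNIV. \<Sum>m\<in>UNIV. P $ m $ b * (M $ j $ a * dN m $ a $ j))"
      by (simp add: con_def sum_distrib_left algebra_simps)
    also have "\<dots> = (\<Sum>m\<in>UNIV. \<Sum>j\<in>UNIV. \<Sum>a\<in>UNIV. P $ m $ b * (M $ j $ a * dN m $ a $ j))"
      by (rule sum_rotate3)
    finally show ?thesis by (simp add: trace_def matrix_matrix_mult_def sum_distrib_left)
  qed
  have T3: "con (\<lambda>a j. \<Sum>m\<in>UNIV. P $ m $ a * dN m $ b $ j) = ?Y"
  proof -
    have "con (\<lambda>a j. \<Sum>m\<in>UNIV. P $ m $ a * dN m $ b $ j)
        = (\<Sum>a\<in>UNIV. \<Sum>j\<in>UNIV. \<Sum>m\<in>UNIV. P $ m $ a * M $ j $ a * dN m $ b $ j)"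
      by (simp add: con_def sum_distrib_left algebra_simps)
    also have "\<dots> = (\<Sum>m\<in>UNIV. \<Sum>j\<in>UNIV. \<Sum>a\<in>UNIV. P $ m $ a * M $ j $ a * dN m $ b $ j)"
      by (rule sum_rotate3)
    finally show ?thesis
      by (simp add: MP) (simp add: matrix_matrix_mult_def transpose_def sum_distrib_right)
  qed
  have T5: "con (\<lambda>a j. \<Sum>l\<in>UNIV. N $ l $ j * dP l $ a $ b) = con (\<lambda>a j. (N ** dP j) $ a $ b)"
  proof -
    have "con (\<lambda>a j. \<Sum>l\<in>UNIV. N $ l $ j * dP l $ a $ b)
        = (\<Sum>a\<in>UNIV. \<Sum>j\<in>UNIV. \<Sum>l\<in>UNIV. N $ l $ j * M $ j $ a * dP l $ a $ b)"
      by (simp add: con_def sum_distrib_left algebra_simps)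
    also have "\<dots> = (\<Sum>a\<in>UNIV. \<Sum>l\<in>UNIV. \<Sum>j\<in>UNIV. N $ l $ j * M $ j $ a * dP l $ a $ b)"
      by (intro sum.cong refl sum.swap)
    also have "\<dots> = (\<Sum>l\<in>UNIV. \<Sum>a\<in>UNIV. \<Sum>j\<in>UNIV. N $ l $ j * M $ j $ a * dP l $ a $ b)"
      by (rule sum.swap)
    finally show ?thesis
      by (simp add: con_mult MN) (simp add: matrix_matrix_mult_def sum_distrib_right)
  qed
  have Y': "con (\<lambda>a j. (P ** transpose (dN j)) $ a $ b) = ?Y"
    unfolding con_mult by (simp add: transpose_def)
  have "con (\<lambda>a j. (N ** dP j) $ a $ b + (dN j ** P) $ a $ b)
      = con (\<lambda>a j. (P ** transpose (dN j)) $ a $ b + (dP j ** transpose N) $ a $ b)"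
    by (intro arg_cong[of _ _ con] ext) (metis dNP vector_add_component)
  moreover have "con (\<lambda>a j. (dN j ** P) $ a $ b)
      = (\<Sum>m\<in>UNIV. P $ m $ b * trace (M ** dN m)) - ?Y
        + con (\<lambda>a j. (dP j ** transpose N) $ a $ b) - con (\<lambda>a j. (N ** dP j) $ a $ b)"
    unfolding conc con_add con_diff T2 T3 T5 ..
  ultimately have "2 * ?Y = (\<Sum>m\<in>UNIV. P $ m $ b * trace (M ** dN m))"
    unfolding con_add Y' by argo
  moreover have "P $ m $ b = - P $ b $ m" for m
    using arg_cong[OF skew, of "\<lambda>A. A $ b $ m"] by (simp add: transpose_def)
  ultimately show ?thesis by (simp add: sum_negf)
qed

section \<open>Poisson-Nijenhuis manifolds\<close>

lemma smooth_on_has_derivative: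
  assumes "smooth_on f S" "x \<in> S"
  shows "(f has_derivative frechet_derivative f (at x)) (at x)"
  using assms Ck_on_has_derivative unfolding smooth_on_def by blast

text \<open>Testing the definition of the modular field on a function that agrees with a coordinate near
  the point isolates one component of the field.\<close>

lemma modular_field_component:
  fixes A :: "('m::{t2_space, second_countable_topology}, 'n::finite) chart set"
  assumes A: "smooth_atlas A" and c: "c \<in> A" and x: "x \<in> chart_image c"
    and X: "is_modular_vector_field A Q \<mu> X"
    and Q': "(Q c has_derivative Q') (at x)"
    and \<mu>: "alternating_form (\<mu> c x)" "\<mu> c x v \<noteq> 0"
  shows "X c x $ b * \<mu> c x v = frechet_derivative (\<lambda>y. \<mu> c y v) (at x) (Q c x *v axis b 1)
    + (\<Sum>m\<in>UNIV. Q' (axis m 1) $ m $ b) * \<mu> c x v"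
proof -
  obtain F where F: "smooth_function A F" "\<forall>\<^sub>F y in nhds x. local_rep F c y = y $ b"
    using coordinate_function_exists[OF A c x] by metis
  have "d_fun (local_rep F c) x = axis b 1"
    using eventually_nhds_x_imp_x[OF d_fun_coordinate[OF F(2)]] .
  then have "X c x \<bullet> d_fun (local_rep F c) x = X c x $ b"
    by (simp add: inner_axis)
  moreover have "(X c x \<bullet> d_fun (local_rep F c) x) * \<mu> c x v
      = lie_top_form (ham (Q c) (local_rep F c)) (\<mu> c) x v"
    using X F(1) c x unfolding is_modular_vector_field_def by blast
  ultimately show ?thesis
    using lie_top_form_ham_coordinate[of _ b x "Q c" Q' "\<mu> c" v, OF F(2) Q' \<mu>] by simp
qed

lemma compatible_pair_concomitant:
  fixes A :: "('m::{t2_space, second_countable_topology}, 'n::finite) chart set"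
  assumes A: "smooth_atlas A" and c: "c \<in> A" and x: "x \<in> chart_image c"
    and PN: "compatible_pair A P N" and skew: "transpose (P c x) = - P c x"
    and P': "(P c has_derivative P') (at x)" and N': "(N c has_derivative N') (at x)"
  shows "(N' (axis j 1) ** P c x) $ a $ b =
      (\<Sum>m\<in>UNIV. P c x $ m $ b * N' (axis m 1) $ a $ j)
      - (\<Sum>m\<in>UNIV. P c x $ m $ a * N' (axis m 1) $ b $ j)
      + (P' (axis j 1) ** transpose (N c x)) $ a $ b
      - (\<Sum>l\<in>UNIV. N c x $ l $ j * P' (axis l 1) $ a $ b)"
proof -
  obtain F where F: "smooth_function A F" "\<forall>\<^sub>F y in nhds x. local_rep F c y = y $ a"
    using coordinate_function_exists[OF A c x] by metis
  obtain G where G: "smooth_function A G" "\<forall>\<^sub>F y in nhds x. local_rep G c y = y $ b"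
    using coordinate_function_exists[OF A c x] by metis
  let ?\<alpha> = "\<lambda>c. d_fun (local_rep F c)" and ?\<beta> = "\<lambda>c. d_fun (local_rep G c)"
  have "form_bracket (\<lambda>y. N c y ** P c y) (?\<alpha> c) (?\<beta> c) x =
            form_bracket (P c) (\<lambda>y. transpose (N c y) *v ?\<alpha> c y) (?\<beta> c) x +
            form_bracket (P c) (?\<alpha> c) (\<lambda>y. transpose (N c y) *v ?\<beta> c y) x -
            transpose (N c x) *v form_bracket (P c) (?\<alpha> c) (?\<beta> c) x"
    using PN[unfolded compatible_pair_def, THEN conjunct2, rule_format,
      OF one_form_differential[OF A F(1)] one_form_differential[OF A G(1)] c x] .
  moreover have "N c x ** P c x = P c x ** transpose (N c x)"
    using PN[unfolded compatible_pair_def, THEN conjunct1, rule_format, OF c x] .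
  ultimately show ?thesis
    using concomitant_in_coordinates[of "P c" x "N c", OF skew _ P' N' d_fun_coordinate[OF F(2)]
      d_fun_coordinate[OF G(2)]] by blast
qed

theorem proposition2p2:
  fixes A :: "('m::{t2_space, second_countable_topology}, 'n::finite) chart set"
    and P N :: "('m, 'n, real ^ 'n ^ 'n) field"
    and \<mu> :: "('m, 'n, real ^ 'n ^ 'n \<Rightarrow> real) field"
    and X :: "nat \<Rightarrow> ('m, 'n, real ^ 'n) field"
  assumes "poisson_nijenhuis_manifold A P N"
    and "volume_form A \<mu>"
    and "\<And>k. is_modular_vector_field A (hierarchy P N k) \<mu> (X k)"
  shows "\<forall>k\<ge>1. \<forall>c\<in>A. \<forall>x\<in>chart_image c.
           kth_modular_field N X k c x = - (1 / 2) *\<^sub>R ham (P c) (trace_function N k c) x"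
proof (intro allI impI ballI)
  fix k :: nat and c x
  assume k: "k \<ge> 1" and c: "c \<in> A" and x: "x \<in> chart_image c"
  then obtain p where p: "k = Suc p" by (cases k) auto
  have A: "smooth_atlas A" and PN: "compatible_pair A P N"
    and "bivector_field A P" "endo_field A N"
    using assms(1) unfolding poisson_nijenhuis_manifold_def poisson_bivector_def nijenhuis_tensor_def
    by blast+
  then have skew: "transpose (P c x) = - P c x"
    and "smooth_on (P c) (chart_image c)" "smooth_on (N c) (chart_image c)"
    using c x unfolding bivector_field_def endo_field_def by blast+
  then obtain P' N' where P': "(P c has_derivative P') (at x)" and N': "(N c has_derivative N') (at x)"
    using smooth_on_has_derivative[OF _ x] by blast
  have open_c: "open (chart_image c)"
    using A c unfolding smooth_atlas_def is_chart_def by blast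
  have NP: "N c y ** P c y = P c y ** transpose (N c y)" if "y \<in> chart_image c" for y
    using PN c that unfolding compatible_pair_def by blast
  define M where "M = mpow (N c x) p"
  define Q where "Q = hierarchy P N p c"

  obtain v where v: "\<mu> c x v \<noteq> 0" and alt: "alternating_form (\<mu> c x)"
    and "smooth_on (\<lambda>y. \<mu> c y v) (chart_image c)"
    using assms(2) c x unfolding volume_form_def by blast
  then have linear_d\<mu>: "linear (frechet_derivative (\<lambda>y. \<mu> c y v) (at x))"
    using smooth_on_has_derivative[OF _ x] has_derivative_linear by blast

  \<comment> \<open>The next bivector is written with \<open>N\<^sup>t\<close> on the right, because the divergence is taken over the
    left index and the derivative that survives must fall on the other factor.\<close>
  have Q_Suc: "hierarchy P N (Suc p) c y = Q y ** transpose (N c y)" if "y \<in> chart_image c" for y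
  proof -
    have "N c y ** mpow (N c y) p ** P c y = mpow (N c y) p ** (N c y ** P c y)"
      by (simp add: mpow_commute matrix_mul_assoc)
    then show ?thesis
      by (simp add: hierarchy_def Q_def NP[OF that] matrix_mul_assoc)
  qed
  \<comment> \<open>The derivative of \<open>Q\<close> itself never has to be computed, as it cancels in the difference of the
    two modular fields.\<close>
  obtain D where "((\<lambda>y. mpow (N c y) p) has_derivative D) (at x)"
    using mpow_has_derivative_trace[OF N', of p] by blast
  from has_derivative_matrix_matrix_mult[OF this P']
  obtain Q' where Q': "(Q has_derivative Q') (at x)"
    unfolding Q_def hierarchy_def by blast
  let ?QS' = "\<lambda>h. Q x ** transpose (N' h) + Q' h ** transpose (N c x)"
  have "((\<lambda>y. Q y ** transpose (N c y)) has_derivative ?QS') (at x)"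
    by (intro has_derivative_matrix_matrix_mult has_derivative_transpose Q' N')
  then have QS': "(hierarchy P N (Suc p) c has_derivative ?QS') (at x)"
    by (rule has_derivative_transform_within_open[OF _ open_c x]) (simp add: Q_Suc)

  have modular: "(X (Suc p) c x - N c x *v X p c x) $ b
      = (\<Sum>m\<in>UNIV. \<Sum>l\<in>UNIV. Q x $ m $ l * N' (axis m 1) $ b $ l)" for b
  proof (rule modular_difference[where Q' = "\<lambda>m. Q' (axis m 1)", OF linear_d\<mu> v])
    show "X p c x $ l * \<mu> c x v = frechet_derivative (\<lambda>y. \<mu> c y v) (at x) (Q x *v axis l 1)
        + (\<Sum>m\<in>UNIV. Q' (axis m 1) $ m $ l) * \<mu> c x v" for l
      using modular_field_component[OF A c x assms(3)[of p] Q'[unfolded Q_def] alt v]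
      unfolding Q_def .
    show "X (Suc p) c x $ l * \<mu> c x v
        = frechet_derivative (\<lambda>y. \<mu> c y v) (at x) ((Q x ** transpose (N c x)) *v axis l 1)
        + (\<Sum>m\<in>UNIV. ?QS' (axis m 1) $ m $ l) * \<mu> c x v" for l
      using modular_field_component[OF A c x assms(3)[of "Suc p"] QS' alt v]
      unfolding Q_Suc[OF x] .
  qed

  \<comment> \<open>Both sides differentiate the same tensor, since \<open>N P = P N\<^sup>t\<close> holds around the point.\<close>
  have dNP: "N c x ** P' h + N' h ** P c x = P c x ** transpose (N' h) + P' h ** transpose (N c x)" for h
  proof -
    have "((\<lambda>y. P c y ** transpose (N c y)) has_derivative
        (\<lambda>h. P c x ** transpose (N' h) + P' h ** transpose (N c x))) (at x)"
      by (intro has_derivative_matrix_matrix_mult has_derivative_transpose P' N')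
    then have "((\<lambda>y. N c y ** P c y) has_derivative
        (\<lambda>h. P c x ** transpose (N' h) + P' h ** transpose (N c x))) (at x)"
      by (rule has_derivative_transform_within_open[OF _ open_c x]) (simp add: NP)
    from has_derivative_unique[OF has_derivative_matrix_matrix_mult[OF N' P'] this]
    show ?thesis by (rule fun_cong)
  qed
  have contracted: "(\<Sum>m\<in>UNIV. \<Sum>l\<in>UNIV. (M ** P c x) $ m $ l * N' (axis m 1) $ b $ l)
      = - (1 / 2) * (\<Sum>m\<in>UNIV. P c x $ b $ m * trace (M ** N' (axis m 1)))" for b
  proof (rule contracted_concomitant[where dP = "\<lambda>m. P' (axis m 1)" and N = "N c x"])
    show "M ** P c x = P c x ** transpose M"
      unfolding M_def by (rule mpow_intertwine[OF NP[OF x]])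
    show "M ** N c x = N c x ** M"
      unfolding M_def by (rule mpow_commute)
  qed (rule skew dNP compatible_pair_concomitant[OF A c x PN skew P' N'])+

  have "((\<lambda>y. trace (mpow (N c y) k) / real k) has_derivative
      (\<lambda>h. real k * trace (M ** N' h) / real k)) (at x)"
    unfolding M_def p
    by (rule bounded_linear.has_derivative[OF bounded_linear_divide trace_mpow_has_derivative[OF N']])
  then have "frechet_derivative (trace_function N k c) (at x) = (\<lambda>h. trace (M ** N' h))"
    using k frechet_derivative_at[symmetric] by (fastforce simp: trace_function_def[abs_def])
  then have "d_fun (trace_function N k c) x $ m = trace (M ** N' (axis m 1))" for m
    by (simp add: d_fun_def)
  then have "ham (P c) (trace_function N k c) x $ b
      = (\<Sum>m\<in>UNIV. P c x $ b $ m * trace (M ** N' (axis m 1)))" for b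
    by (simp add: ham_def matrix_vector_mult_def)
  moreover have "Q x = M ** P c x"
    by (simp add: Q_def hierarchy_def M_def)
  ultimately show "kth_modular_field N X k c x = - (1 / 2) *\<^sub>R ham (P c) (trace_function N k c) x"
    using modular contracted by (simp add: vec_eq_iff kth_modular_field_def p)
qed

end
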